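(* Let $k$ be a commutative ring of characteristic $m>0$, let $p$ be a prime number, let $G$ be a compact $p$-adic analytic group, and let $V$ be a smooth representation of $G$ on a $k$-module. Then every $1$-cocycle $\chi\colon G\to V$ is continuous, where $V$ carries the discrete topology. In particular, the comparison map $\varphi^1\colon H^1_{\mathrm{cont}}(G,V)\to H^1_{\mathrm{abs}}(G,V)$ is an isomorphism.
   Context: A $p$-adic analytic group is a topological group carrying the structure of a $p$-adic analytic manifold over $\mathbb{Q}_p$ with analytic group operations; equivalently, a topological group containing an open subgroup that is a finitely generated powerful pro-$p$ group. (A pro-$p$ group $U$ is powerful if $p$ is odd and $U/\overline{U^p}$ is abelian, or $p=2$ and $U/\overline{U^4}$ is abelian, where $U^n$ is the subgroup generated by the $n$-th powers and the bar denotes topological closure.) The prime $p$ and the characteristic $m$ of $k$ are not assumed to be related. A representation of $G$ on a $k$-module $V$ is a $k$-linear action of the abstract group $G$ on $V$. It is smooth if the action map $G\times V\to V$ is continuous when $V$ has the discrete topology; equivalently, the stabilizer of every $v\in V$ is open in $G$. A $1$-cocycle is an arbitrary map $\chi\colon G\to V$ (no continuity imposed) with $\chi(gh)=\chi(g)+g\cdot\chi(h)$ for all $g,h\in G$. $H^q_{\mathrm{abs}}(G,V)$ is the $q$-th cohomology group of $G$ viewed as an abstract group; $H^q_{\mathrm{cont}}(G,V)$ is the $q$-th continuous (profinite) cohomology group, i.e. the cohomology of continuous cochains with $V$ discrete. The comparison map $\varphi^q\colon H^q_{\mathrm{cont}}(G,V)\to H^q_{\mathrm{abs}}(G,V)$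 is induced by the inclusion of continuous cochains into all cochains. *)

theory Defs
  imports
    "HOL-Analysis.Abstract_Topological_Spaces"
    "HOL-Algebra.Algebra"
begin

section \<open>Topological groups\<close>

locale topological_group = group G for G (structure) +
  fixes T :: "'a topology"
  assumes topspace_eq_carrier: "topspace T = carrier G"
    and continuous_mult: "continuous_map (prod_topology T T) T (\<lambda>(x, y). x \<otimes> y)"
    and continuous_inv: "continuous_map T T (\<lambda>x. inv x)"

locale profinite_group = topological_group +
  assumes compact: "compact_space T"
    and Hausdorff: "Hausdorff_space T"
    and open_subgroups_base:
      "\<And>W. openin T W \<Longrightarrow> \<one> \<in> W \<Longrightarrow> \<exists>H. subgroup H G \<and> openin T H \<and> H \<subseteq> W"

locale pro_p_group = profinite_group G T for p :: nat and G (structure) and T +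
  assumes index_open_normal: "\<And>N. N \<lhd> G \<Longrightarrow> openin T N \<Longrightarrow> \<exists>n. card (rcosets N) = p ^ n"

definition topologically_finitely_generated ::
  "('a, 'b) monoid_scheme \<Rightarrow> 'a topology \<Rightarrow> bool" where
  "topologically_finitely_generated G T \<longleftrightarrow>
     (\<exists>S. finite S \<and> S \<subseteq> carrier G \<and> Abstract_Topology.closure_of T (generate G S) = carrier G)"

definition power_subgroup :: "('a, 'b) monoid_scheme \<Rightarrow> nat \<Rightarrow> 'a set" where
  "power_subgroup G n = generate G ((\<lambda>x. x [^]\<^bsub>G\<^esub> n) ` carrier G)"

definition powerful :: "nat \<Rightarrow> ('a, 'b) monoid_scheme \<Rightarrow> 'a topology \<Rightarrow> bool" where
  "powerful p G T \<longleftrightarrow>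
     (odd p \<and> comm_group (G Mod (Abstract_Topology.closure_of T (power_subgroup G p)))) \<or>
     (p = 2 \<and> comm_group (G Mod (Abstract_Topology.closure_of T (power_subgroup G 4))))"

text \<open>
  We take Lazard's description of \<open>p\<close>-adic analytic groups as the definition. Finite generation of a
  pro-\<open>p\<close> group is understood topologically, as usual.
\<close>

definition p_adic_analytic_group :: "nat \<Rightarrow> ('a, 'b) monoid_scheme \<Rightarrow> 'a topology \<Rightarrow> bool" where
  "p_adic_analytic_group p G T \<longleftrightarrow>
     topological_group G T \<and>
     (\<exists>U. subgroup U G \<and> openin T U \<and>
          pro_p_group p (G\<lparr>carrier := U\<rparr>) (subtopology T U) \<and>
          topologically_finitely_generated (G\<lparr>carrier := U\<rparr>) (subtopology T U) \<and>
          powerful p (G\<lparr>carrier := U\<rparr>) (subtopology T U))"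


section \<open>Smooth representations\<close>

text \<open>
  The characteristic is the additive order of \<open>1\<close>; \<^const>\<open>group.ord\<close> is \<open>0\<close> on elements of
  infinite order.
\<close>

definition ring_characteristic :: "('a, 'b) ring_scheme \<Rightarrow> nat" where
  "ring_characteristic K = group.ord (add_monoid K) \<one>\<^bsub>K\<^esub>"

text \<open>
  In \<^locale>\<open>group_action\<close> each \<open>\<rho> g\<close> is a bijection of \<^term>\<open>carrier V\<close> which is
  \<^const>\<open>undefined\<close> outside of \<^term>\<open>carrier V\<close>.
\<close>

locale group_representation =
  module K V + group_action G "carrier V" \<rho>
  for K :: "('k, 'r) ring_scheme" and G :: "('g, 's) monoid_scheme"
    and V :: "('k, 'v, 't) module_scheme" and \<rho> :: "'g \<Rightarrow> 'v \<Rightarrow> 'v" +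
  assumes action_add:
      "\<And>g v w. g \<in> carrier G \<Longrightarrow> v \<in> carrier V \<Longrightarrow> w \<in> carrier V \<Longrightarrow>
         \<rho> g (v \<oplus>\<^bsub>V\<^esub> w) = \<rho> g v \<oplus>\<^bsub>V\<^esub> \<rho> g w"
    and action_smult:
      "\<And>g a v. g \<in> carrier G \<Longrightarrow> a \<in> carrier K \<Longrightarrow> v \<in> carrier V \<Longrightarrow>
         \<rho> g (a \<odot>\<^bsub>V\<^esub> v) = a \<odot>\<^bsub>V\<^esub> \<rho> g v"

locale smooth_representation =
  topological_group G T + group_representation K G V \<rho>
  for K :: "('k, 'r) ring_scheme" and G :: "('g, 's) monoid_scheme" and T :: "'g topology"
    and V :: "('k, 'v, 't) module_scheme" and \<rho> :: "'g \<Rightarrow> 'v \<Rightarrow> 'v" +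
  assumes smooth:
    "continuous_map (prod_topology T (discrete_topology (carrier V)))
       (discrete_topology (carrier V)) (\<lambda>(g, v). \<rho> g v)"

definition one_cocycle ::
  "('g, 's) monoid_scheme \<Rightarrow> ('k, 'v, 't) module_scheme \<Rightarrow> ('g \<Rightarrow> 'v \<Rightarrow> 'v) \<Rightarrow> ('g \<Rightarrow> 'v) \<Rightarrow> bool"
  where
  "one_cocycle G V \<rho> c \<longleftrightarrow>
     c \<in> carrier G \<rightarrow> carrier V \<and>
     (\<forall>g\<in>carrier G. \<forall>h\<in>carrier G. c (g \<otimes>\<^bsub>G\<^esub> h) = c g \<oplus>\<^bsub>V\<^esub> \<rho> g (c h))"


section \<open>Abstract and continuous cohomology\<close>

text \<open>
  Inhomogeneous cochains. An element \<open>(x\<^sub>1, \<dots>, x\<^sub>q)\<close> of \<open>G\<^sup>q\<close> is the extensional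
  function \<open>i \<mapsto> x\<^sub>i\<^sub>+\<^sub>1\<close> on \<open>{..<q}\<close>, and cochains are extensional functions on \<open>G\<^sup>q\<close>.
\<close>

definition tuples :: "('g, 's) monoid_scheme \<Rightarrow> nat \<Rightarrow> (nat \<Rightarrow> 'g) set" where
  "tuples G q = {..<q} \<rightarrow>\<^sub>E carrier G"

definition cochains_abs ::
  "('g, 's) monoid_scheme \<Rightarrow> ('k, 'v, 't) module_scheme \<Rightarrow> nat \<Rightarrow> ((nat \<Rightarrow> 'g) \<Rightarrow> 'v) set" where
  "cochains_abs G V q = tuples G q \<rightarrow>\<^sub>E carrier V"

definition cochains_cont ::
  "('g, 's) monoid_scheme \<Rightarrow> 'g topology \<Rightarrow> ('k, 'v, 't) module_scheme \<Rightarrow> nat \<Rightarrow>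
     ((nat \<Rightarrow> 'g) \<Rightarrow> 'v) set" where
  "cochains_cont G T V q =
     {f \<in> cochains_abs G V q.
        continuous_map (product_topology (\<lambda>_. T) {..<q}) (discrete_topology (carrier V)) f}"

text \<open>
  \<open>face G q 0\<close> drops \<open>x\<^sub>1\<close> from \<open>(x\<^sub>1, \<dots>, x\<^sub>q\<^sub>+\<^sub>1)\<close>, \<open>face G q (q + 1)\<close> drops \<open>x\<^sub>q\<^sub>+\<^sub>1\<close>, and
  \<open>face G q i\<close> with \<open>1 \<le> i \<le> q\<close> multiplies \<open>x\<^sub>i\<close> and \<open>x\<^sub>i\<^sub>+\<^sub>1\<close>.
\<close>

definition face :: "('g, 's) monoid_scheme \<Rightarrow> nat \<Rightarrow> nat \<Rightarrow> (nat \<Rightarrow> 'g) \<Rightarrow> (nat \<Rightarrow> 'g)" where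
  "face G q i x =
     (\<lambda>j\<in>{..<q}. if j + 1 < i then x j
                 else if j + 1 = i then x j \<otimes>\<^bsub>G\<^esub> x (j + 1)
                 else x (j + 1))"

definition coboundary_map ::
  "('g, 's) monoid_scheme \<Rightarrow> ('k, 'v, 't) module_scheme \<Rightarrow> ('g \<Rightarrow> 'v \<Rightarrow> 'v) \<Rightarrow> nat \<Rightarrow>
     ((nat \<Rightarrow> 'g) \<Rightarrow> 'v) \<Rightarrow> ((nat \<Rightarrow> 'g) \<Rightarrow> 'v)" where
  "coboundary_map G V \<rho> q f =
     (\<lambda>x\<in>tuples G (Suc q).
        \<rho> (x 0) (f (face G q 0 x)) \<oplus>\<^bsub>V\<^esub>
        (\<Oplus>\<^bsub>V\<^esub>i\<in>{1..Suc q}. if even i then f (face G q i x) else \<ominus>\<^bsub>V\<^esub> f (face G q i x)))"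

text \<open>
  The following definitions apply to any subcomplex \<open>C\<close> of the complex of all cochains.
\<close>

definition cocycle_group ::
  "('g, 's) monoid_scheme \<Rightarrow> ('k, 'v, 't) module_scheme \<Rightarrow> ('g \<Rightarrow> 'v \<Rightarrow> 'v) \<Rightarrow>
     (nat \<Rightarrow> ((nat \<Rightarrow> 'g) \<Rightarrow> 'v) set) \<Rightarrow> nat \<Rightarrow> ((nat \<Rightarrow> 'g) \<Rightarrow> 'v) monoid" where
  "cocycle_group G V \<rho> C q =
     \<lparr>carrier = {f \<in> C q. coboundary_map G V \<rho> q f = (\<lambda>x\<in>tuples G (Suc q). \<zero>\<^bsub>V\<^esub>)},
      monoid.mult = (\<lambda>f f'. \<lambda>x\<in>tuples G q. f x \<oplus>\<^bsub>V\<^esub> f' x),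
      one = (\<lambda>x\<in>tuples G q. \<zero>\<^bsub>V\<^esub>)\<rparr>"

fun coboundaries ::
  "('g, 's) monoid_scheme \<Rightarrow> ('k, 'v, 't) module_scheme \<Rightarrow> ('g \<Rightarrow> 'v \<Rightarrow> 'v) \<Rightarrow>
     (nat \<Rightarrow> ((nat \<Rightarrow> 'g) \<Rightarrow> 'v) set) \<Rightarrow> nat \<Rightarrow> ((nat \<Rightarrow> 'g) \<Rightarrow> 'v) set" where
  "coboundaries G V \<rho> C 0 = {\<lambda>x\<in>tuples G 0. \<zero>\<^bsub>V\<^esub>}"
| "coboundaries G V \<rho> C (Suc q) = coboundary_map G V \<rho> q ` C q"

definition cohomology ::
  "('g, 's) monoid_scheme \<Rightarrow> ('k, 'v, 't) module_scheme \<Rightarrow> ('g \<Rightarrow> 'v \<Rightarrow> 'v) \<Rightarrow>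
     (nat \<Rightarrow> ((nat \<Rightarrow> 'g) \<Rightarrow> 'v) set) \<Rightarrow> nat \<Rightarrow> ((nat \<Rightarrow> 'g) \<Rightarrow> 'v) set monoid" where
  "cohomology G V \<rho> C q = cocycle_group G V \<rho> C q Mod coboundaries G V \<rho> C q"

abbreviation H_abs where
  "H_abs G V \<rho> q \<equiv> cohomology G V \<rho> (cochains_abs G V) q"

abbreviation H_cont where
  "H_cont G T V \<rho> q \<equiv> cohomology G V \<rho> (cochains_cont G T V) q"

text \<open>
  A class \<open>\<xi>\<close> of continuous cocycles is sent to the class modulo all coboundaries of its members,
  \<open>f + B\<^sub>c\<^sub>o\<^sub>n\<^sub>t \<mapsto> f + B\<^sub>a\<^sub>b\<^sub>s\<close>.
\<close>

definition comparison_map ::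
  "('g, 's) monoid_scheme \<Rightarrow> ('k, 'v, 't) module_scheme \<Rightarrow> ('g \<Rightarrow> 'v \<Rightarrow> 'v) \<Rightarrow> nat \<Rightarrow>
     ((nat \<Rightarrow> 'g) \<Rightarrow> 'v) set \<Rightarrow> ((nat \<Rightarrow> 'g) \<Rightarrow> 'v) set" where
  "comparison_map G V \<rho> q \<xi> =
     (\<Union>f\<in>\<xi>. r_coset (cocycle_group G V \<rho> (cochains_abs G V) q)
                     (coboundaries G V \<rho> (cochains_abs G V) q) f)"

end

theory Submission
  imports Defs
begin

text \<open>
  Let \<open>c\<close> be a \<open>1\<close>-cocycle. Its zeros form a subgroup \<open>K\<close> of \<open>G\<close>, and \<open>c (g k) = c g + g c k\<close>
  shows that \<open>c\<close> is constant on the cosets \<open>g K\<close>. So \<open>c\<close> is continuous as soon as \<open>K\<close> is open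
  (\<open>continuous_if_kernel_open\<close>). Let \<open>U\<close> be an open subgroup of \<open>G\<close> that is a finitely generated
  powerful pro-\<open>p\<close> group. Two facts together make \<open>K \<inter> U\<close> open.

  First, \<open>K\<close> meets every procyclic subgroup of \<open>U\<close> in an open subgroup
  (\<open>procyclic_subset_kernel\<close>). Given \<open>g\<close>, choose \<open>n\<close> such that the closure \<open>C\<close> of the group
  generated by \<open>g\<^sup>q\<close>, with \<open>q = p\<^sup>n\<close>, fixes \<open>c g\<close>. For \<open>y \<in> C\<close>, computing \<open>c (g y) = c (y g)\<close> in
  two ways gives \<open>g c y = c y\<close>. By smoothness the whole closure of the group generated by \<open>g\<close>
  fixes \<open>c y\<close>, so \<open>c\<close> is additive on powers of \<open>y\<close>, and \<open>c (y\<^sup>m) = m c y = 0\<close>. If \<open>p\<^sup>a\<close> is the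
  \<open>p\<close>-part of \<open>m\<close>, then the \<open>m\<close>-th powers of elements of \<open>C\<close> exhaust the closure of the group
  generated by \<open>g\<close> to the power \<open>p\<^sup>n\<^sup>+\<^sup>a\<close>; hence that closure lies in \<open>K\<close>.

  Second, if \<open>g\<^sub>1, \<dots>, g\<^sub>d\<close> generate \<open>U\<close> topologically, then for every \<open>n\<close> the product of the
  closures of the groups generated by \<open>g\<^sub>1\<^sup>q, \<dots>, g\<^sub>d\<^sup>q\<close>, with \<open>q = p\<^sup>n\<close>, contains a neighbourhood of
  the identity (\<open>powerful_product_neighbourhood\<close>). A subgroup that contains these procyclic
  groups contains their product. By compactness this reduces to the finite \<open>p\<close>-groups \<open>U / N\<close>
  with \<open>N\<close> open and normal. Let \<open>Q 0 = U\<close> and let \<open>Q (i + 1)\<close> be generated by \<open>N\<close> and all \<open>x\<^sup>p\<close>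
  and \<open>[x, g]\<close> with \<open>x \<in> Q i\<close>. Because \<open>U\<close> is powerful, \<open>x \<mapsto> x\<^sup>p\<close> induces a surjective
  homomorphism from \<open>Q i / Q (i + 1)\<close> to \<open>Q (i + 1) / Q (i + 2)\<close> (\<open>Q_powerful\<close>). So the powers
  of the \<open>g\<^sub>j\<close> with exponent \<open>p\<^sup>i\<close> generate \<open>Q i / Q (i + 1)\<close>, which is central in
  \<open>U / Q (i + 1)\<close>, and successive approximation shows that modulo \<open>N\<close> every element of \<open>Q n\<close> is
  an ordered product of powers of \<open>g\<^sub>1\<^sup>q, \<dots>, g\<^sub>d\<^sup>q\<close> (\<open>Q_eq_ordered_prod_mult\<close>).

  For the comparison map, continuity of all \<open>1\<close>-cocycles means that the continuous and the
  abstract cochain complexes have the same \<open>1\<close>-cocycles. They also have the same \<open>0\<close>-cochains,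
  hence the same \<open>1\<close>-coboundaries. So both first cohomology groups are the same quotient, on which
  the comparison map is the identity (\<open>comparison_map_iso\<close>).
\<close>

section \<open>Commutators and powers modulo a normal subgroup\<close>

definition commutator :: "('a, 'b) monoid_scheme \<Rightarrow> 'a \<Rightarrow> 'a \<Rightarrow> 'a" where
  "commutator G x y = inv\<^bsub>G\<^esub> x \<otimes>\<^bsub>G\<^esub> inv\<^bsub>G\<^esub> y \<otimes>\<^bsub>G\<^esub> x \<otimes>\<^bsub>G\<^esub> y"

context group begin

lemma commutator_closed [simp, intro]:
  "x \<in> carrier G \<Longrightarrow> y \<in> carrier G \<Longrightarrow> commutator G x y \<in> carrier G"
  by (simp add: commutator_def)

lemma inv_mult_cancel:
  assumes "g \<in> carrier G" "x \<in> carrier G"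
  shows "inv g \<otimes> (g \<otimes> x) = x" "g \<otimes> (inv g \<otimes> x) = x"
  using assms by (simp_all add: m_assoc[symmetric])

lemma mult_commutator:
  "x \<in> carrier G \<Longrightarrow> y \<in> carrier G \<Longrightarrow> y \<otimes> x \<otimes> commutator G x y = x \<otimes> y"
  by (simp add: commutator_def m_assoc inv_mult_cancel)

lemma commutator_conj:
  assumes "g \<in> carrier G" "x \<in> carrier G" "y \<in> carrier G"
  shows "g \<otimes> commutator G x y \<otimes> inv g = commutator G (g \<otimes> x \<otimes> inv g) (g \<otimes> y \<otimes> inv g)"
  using assms by (simp add: commutator_def m_assoc inv_mult_group inv_mult_cancel)

lemma pow_conj:
  fixes n :: nat
  assumes "g \<in> carrier G" "x \<in> carrier G"
  shows "g \<otimes> x [^] n \<otimes> inv g = (g \<otimes> x \<otimes> inv g) [^] n"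
proof (induction n)
  case (Suc n)
  have "g \<otimes> x [^] Suc n \<otimes> inv g = (g \<otimes> x [^] n \<otimes> inv g) \<otimes> (g \<otimes> x \<otimes> inv g)"
    using assms by (simp add: m_assoc inv_mult_cancel)
  then show ?case using Suc by simp
qed (use assms in simp)

text \<open>
  Moving one \<open>x\<close> to the left past \<open>y\<^sup>n\<close> costs a factor \<open>c\<^sup>n\<close>, and these exponents add up to the
  binomial coefficient.
\<close>

lemma pow_mult_central_commutator:
  fixes n :: nat
  assumes [simp]: "x \<in> carrier G" "y \<in> carrier G" "c \<in> carrier G"
    and yx: "y \<otimes> x = x \<otimes> y \<otimes> c" and cx: "c \<otimes> x = x \<otimes> c" and cy: "c \<otimes> y = y \<otimes> c"
  shows "(x \<otimes> y) [^] n = x [^] n \<otimes> y [^] n \<otimes> c [^] (n choose 2)"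
proof (induction n)
  case (Suc n)
  have pow_x: "y [^] k \<otimes> x = x \<otimes> y [^] k \<otimes> c [^] k" for k :: nat
  proof (induction k)
    case (Suc k)
    have "y [^] Suc k \<otimes> x = y [^] k \<otimes> x \<otimes> (y \<otimes> c)"
      by (simp add: m_assoc yx)
    also have "\<dots> = x \<otimes> y [^] k \<otimes> (c [^] k \<otimes> y) \<otimes> c"
      by (simp add: Suc m_assoc)
    also have "c [^] k \<otimes> y = y \<otimes> c [^] k"
      using group_commutes_pow[OF cy] by simp
    finally show ?case by (simp add: m_assoc)
  qed simp
  have "(x \<otimes> y) [^] Suc n = x [^] n \<otimes> y [^] n \<otimes> (c [^] (n choose 2) \<otimes> x) \<otimes> y"
    by (simp add: Suc m_assoc)
  also have "c [^] (n choose 2) \<otimes> x = x \<otimes> c [^] (n choose 2)"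
    using group_commutes_pow[OF cx] by simp
  also have "x [^] n \<otimes> y [^] n \<otimes> (x \<otimes> c [^] (n choose 2)) \<otimes> y
      = x [^] n \<otimes> (y [^] n \<otimes> x) \<otimes> (c [^] (n choose 2) \<otimes> y)"
    by (simp add: m_assoc)
  also have "c [^] (n choose 2) \<otimes> y = y \<otimes> c [^] (n choose 2)"
    using group_commutes_pow[OF cy] by simp
  also have "x [^] n \<otimes> (y [^] n \<otimes> x) \<otimes> (y \<otimes> c [^] (n choose 2))
      = x [^] Suc n \<otimes> y [^] n \<otimes> (c [^] n \<otimes> y) \<otimes> c [^] (n choose 2)"
    by (simp add: pow_x m_assoc)
  also have "c [^] n \<otimes> y = y \<otimes> c [^] n"
    using group_commutes_pow[OF cy] by simp
  also have "x [^] Suc n \<otimes> y [^] n \<otimes> (y \<otimes> c [^] n) \<otimes> c [^] (n choose 2)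
      = x [^] Suc n \<otimes> y [^] Suc n \<otimes> c [^] (n + (n choose 2))"
    by (simp add: m_assoc nat_pow_mult)
  also have "n + (n choose 2) = (Suc n choose 2)"
    by (simp add: numeral_2_eq_2)
  finally show ?case .
qed (simp add: numeral_2_eq_2)

lemma subgroup_nat_pow_closed: "subgroup S G \<Longrightarrow> x \<in> S \<Longrightarrow> x [^] (n :: nat) \<in> S"
  by (metis int_pow_int subgroup_int_pow_closed)

lemma nat_pow_mem_generate: "x \<in> carrier G \<Longrightarrow> x [^] (n :: nat) \<in> generate G {x}"
  by (rule subgroup_nat_pow_closed[OF generate_is_subgroup]) (auto intro: generate.incl)

end

context normal begin

lemma rcos_eq_iff:
  "x \<in> carrier G \<Longrightarrow> y \<in> carrier G \<Longrightarrow> H #> x = H #> y \<longleftrightarrow> x \<otimes> inv y \<in> H"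
  by (metis is_subgroup m_closed inv_closed rcos_module rcos_self repr_independence subgroup_axioms is_group)

lemma rcos_eq_self_iff: "x \<in> carrier G \<Longrightarrow> H #> x = H \<longleftrightarrow> x \<in> H"
  by (metis coset_join1 coset_join2 is_subgroup subset)

lemma rcos_mult_eq:
  assumes "H #> x = H #> x'" "H #> y = H #> y'"
    "x \<in> carrier G" "x' \<in> carrier G" "y \<in> carrier G" "y' \<in> carrier G"
  shows "H #> (x \<otimes> y) = H #> (x' \<otimes> y')"
  using assms by (metis rcos_sum)

lemma rcos_mult_mem:
  assumes "x \<in> carrier G" "h \<in> H"
  shows "H #> (x \<otimes> h) = H #> x"
  using assms by (simp add: rcos_eq_iff inv_op_closed2)

lemma rcos_eq_iff_left:
  assumes "x \<in> carrier G" "y \<in> carrier G"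
  shows "H #> x = H #> y \<longleftrightarrow> inv y \<otimes> x \<in> H"
proof -
  have "x \<otimes> inv y \<in> H \<longleftrightarrow> inv y \<otimes> x \<in> H"
    using inv_op_closed1[of y "x \<otimes> inv y"] inv_op_closed2[of y "inv y \<otimes> x"] assms
    by (auto simp: m_assoc inv_mult_cancel)
  then show ?thesis using assms by (simp add: rcos_eq_iff)
qed

lemma commutator_mem_iff:
  assumes "x \<in> carrier G" "y \<in> carrier G"
  shows "commutator G x y \<in> H \<longleftrightarrow> H #> (x \<otimes> y) = H #> (y \<otimes> x)"
proof
  assume "commutator G x y \<in> H"
  then show "H #> (x \<otimes> y) = H #> (y \<otimes> x)"
    using assms by (metis mult_commutator rcos_mult_mem m_closed)
next
  assume eq: "H #> (x \<otimes> y) = H #> (y \<otimes> x)"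
  have "inv (y \<otimes> x) \<otimes> (x \<otimes> y) \<in> H"
    using eq assms rcos_eq_iff_left by simp
  then show "commutator G x y \<in> H"
    using assms by (simp add: commutator_def m_assoc inv_mult_group inv_mult_cancel)
qed

lemma commutator_mem:
  assumes "x \<in> H" "y \<in> carrier G"
  shows "commutator G x y \<in> H"
  using assms by (simp add: commutator_mem_iff rcos_mult_mem)
    (metis coset_join2 coset_mult_assoc is_subgroup mem_carrier subset)

text \<open>
  The preceding formula, read in \<open>G / H\<close>: the image of the commutator is central and its
  contribution vanishes, so the \<open>n\<close>-th power of the product is multiplicative modulo \<open>H\<close>.
\<close>

lemma rcos_pow_mult:
  fixes n :: nat
  assumes x: "x \<in> carrier G" and y: "y \<in> carrier G"
    and comm: "\<And>g. g \<in> carrier G \<Longrightarrow> commutator G (commutator G y x) g \<in> H"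
    and pow: "commutator G y x [^] (n choose 2) \<in> H"
  shows "H #> (x \<otimes> y) [^] n = H #> (x [^] n \<otimes> y [^] n)"
proof -
  interpret F: group "G Mod H" by (rule factorgroup_is_group)
  define \<pi> where "\<pi> = (\<lambda>a. H #> a)"
  have \<pi>_closed: "\<pi> a \<in> carrier (G Mod H)" if "a \<in> carrier G" for a
    using that by (auto simp: carrier_FactGroup \<pi>_def)
  have \<pi>_mult: "\<pi> a \<otimes>\<^bsub>G Mod H\<^esub> \<pi> b = \<pi> (a \<otimes> b)" if "a \<in> carrier G" "b \<in> carrier G" for a b
    using that by (simp add: \<pi>_def rcos_sum)
  have \<pi>_pow: "\<pi> a [^]\<^bsub>G Mod H\<^esub> k = \<pi> (a [^] k)" if "a \<in> carrier G" for a and k :: nat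
    using that by (simp add: \<pi>_def FactGroup_pow)
  let ?c = "commutator G y x"
  have central: "\<pi> ?c \<otimes>\<^bsub>G Mod H\<^esub> \<pi> g = \<pi> g \<otimes>\<^bsub>G Mod H\<^esub> \<pi> ?c" if g: "g \<in> carrier G" for g
    using comm[OF g] g x y
    by (simp add: commutator_mem_iff \<pi>_mult \<pi>_def[symmetric] del: mult_FactGroup)
  have yx: "\<pi> y \<otimes>\<^bsub>G Mod H\<^esub> \<pi> x = \<pi> x \<otimes>\<^bsub>G Mod H\<^esub> \<pi> y \<otimes>\<^bsub>G Mod H\<^esub> \<pi> ?c"
    using x y by (simp add: \<pi>_mult mult_commutator del: mult_FactGroup)
  have "(\<pi> x \<otimes>\<^bsub>G Mod H\<^esub> \<pi> y) [^]\<^bsub>G Mod H\<^esub> n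
      = \<pi> x [^]\<^bsub>G Mod H\<^esub> n \<otimes>\<^bsub>G Mod H\<^esub> \<pi> y [^]\<^bsub>G Mod H\<^esub> n \<otimes>\<^bsub>G Mod H\<^esub> \<pi> ?c [^]\<^bsub>G Mod H\<^esub> (n choose 2)"
    by (rule F.pow_mult_central_commutator)
      (use x y \<pi>_closed yx central in \<open>auto simp del: mult_FactGroup\<close>)
  also have "\<pi> ?c [^]\<^bsub>G Mod H\<^esub> (n choose 2) = \<one>\<^bsub>G Mod H\<^esub>"
    using pow x y by (simp add: \<pi>_pow) (simp add: \<pi>_def rcos_eq_self_iff)
  finally have "\<pi> ((x \<otimes> y) [^] n) = \<pi> (x [^] n \<otimes> y [^] n)"
    using x y \<pi>_closed by (simp add: \<pi>_pow \<pi>_mult del: mult_FactGroup one_FactGroup)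
  then show ?thesis
    by (simp add: \<pi>_def)
qed

end

section \<open>The lower \<open>p\<close>-series of a powerful quotient\<close>

text \<open>
  This is the lower \<open>p\<close>-series of \<open>G / N\<close>, pulled back to \<open>G\<close>. Keeping \<open>N\<close> inside every term
  allows all computations to take place in \<open>G\<close> itself while \<open>N\<close> varies.
\<close>

primrec lower_p_series :: "('a, 'b) monoid_scheme \<Rightarrow> nat \<Rightarrow> 'a set \<Rightarrow> nat \<Rightarrow> 'a set" where
  "lower_p_series G p N 0 = carrier G"
| "lower_p_series G p N (Suc i) =
     generate G ((\<lambda>x. x [^]\<^bsub>G\<^esub> p) ` lower_p_series G p N i
       \<union> case_prod (commutator G) ` (lower_p_series G p N i \<times> carrier G) \<union> N)"

declare lower_p_series.simps(2) [simp del]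

text \<open>
  The last assumption says that \<open>G / N\<close> is powerful. For \<open>p = 2\<close> squares would not suffice, because
  the quotient of any group by its squares is abelian.
\<close>

locale powerful_modulo = normal N G for N and G (structure) +
  fixes p :: nat
  assumes prime: "Factorial_Ring.prime p"
    and powerful: "\<And>x g. x \<in> carrier G \<Longrightarrow> g \<in> carrier G \<Longrightarrow>
      commutator G x g \<in> generate G ((\<lambda>y. y [^] (if p = 2 then 4 else p)) ` carrier G \<union> N)"
begin

abbreviation Q where "Q \<equiv> lower_p_series G p N"

lemma Q_normal: "Q i \<lhd> G"
proof (induction i)
  case 0
  show ?case by (simp add: normal_self)
next
  case (Suc i)
  interpret Qi: normal "Q i" G by (rule Suc)
  have conj_pow: "g \<otimes> x [^] p \<otimes> inv g \<in> (\<lambda>x. x [^] p) ` Q i" if "g \<in> carrier G" "x \<in> Q i" for g x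
    using that by (auto simp: pow_conj intro!: imageI Qi.inv_op_closed2)
  have conj_comm: "g \<otimes> commutator G x y \<otimes> inv g \<in> case_prod (commutator G) ` (Q i \<times> carrier G)"
    if "g \<in> carrier G" "x \<in> Q i" "y \<in> carrier G" for g x y
    using that
    by (auto simp: commutator_conj
        intro!: image_eqI[of _ _ "(g \<otimes> x \<otimes> inv g, g \<otimes> y \<otimes> inv g)"] Qi.inv_op_closed2)
  show ?case
    unfolding lower_p_series.simps
    by (rule normal_generateI)
      (use conj_pow conj_comm inv_op_closed2 in \<open>auto simp: subset[THEN subsetD]\<close>)
qed

lemma Q_closed: "x \<in> Q i \<Longrightarrow> x \<in> carrier G"
  using Q_normal[of i] by (meson normal_imp_subgroup subgroup.mem_carrier)

lemma N_subset_Q: "N \<subseteq> Q i"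
  by (cases i) (auto simp: lower_p_series.simps(2) subset[THEN subsetD] intro: generate.incl)

lemma pow_mem_Q_Suc: "x \<in> Q i \<Longrightarrow> x [^] p \<in> Q (Suc i)"
  by (auto simp: lower_p_series.simps(2) intro!: generate.incl)

lemma commutator_mem_Q_Suc: "x \<in> Q i \<Longrightarrow> g \<in> carrier G \<Longrightarrow> commutator G x g \<in> Q (Suc i)"
  by (auto simp: lower_p_series.simps(2) intro!: generate.incl)

lemma Q_Suc_subset_subgroup:
  assumes "subgroup S G" "N \<subseteq> S" "\<And>x. x \<in> Q i \<Longrightarrow> x [^] p \<in> S"
    "\<And>x g. x \<in> Q i \<Longrightarrow> g \<in> carrier G \<Longrightarrow> commutator G x g \<in> S"
  shows "Q (Suc i) \<subseteq> S"
  unfolding lower_p_series.simps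
  by (rule generate_subgroup_incl) (use assms in auto)

lemma Q_antimono: "i \<le> j \<Longrightarrow> Q j \<subseteq> Q i"
proof (induction j rule: dec_induct)
  case (step j)
  interpret Qj: normal "Q j" G by (rule Q_normal)
  have "Q (Suc j) \<subseteq> Q j"
    by (rule Q_Suc_subset_subgroup)
      (use Qj.is_subgroup N_subset_Q Qj.commutator_mem in
        \<open>auto intro: subgroup_nat_pow_closed\<close>)
  then show ?case using step by blast
qed simp

lemma pow_pow_mem_Q: "x \<in> carrier G \<Longrightarrow> x [^] (p ^ n) \<in> Q n"
proof (induction n)
  case (Suc n)
  then have "(x [^] (p ^ n)) [^] p \<in> Q (Suc n)"
    by (intro pow_mem_Q_Suc) auto
  then show ?case using Suc by (simp add: nat_pow_pow mult.commute)
qed simp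

text \<open>
  Commutators with elements of \<open>Q i\<close> lie in \<open>Q (i + 1)\<close> and are therefore central modulo
  \<open>Q (i + 2)\<close>, so only their order matters for the multiplicativity of \<open>p\<close>-th powers.
\<close>

lemma rcos_Q_pow_mult:
  assumes "x \<in> carrier G" "y \<in> Q i" "commutator G y x [^] (p choose 2) \<in> Q (i + 2)"
  shows "Q (i + 2) #> (x \<otimes> y) [^] p = Q (i + 2) #> (x [^] p \<otimes> y [^] p)"
proof -
  interpret M: normal "Q (i + 2)" G by (rule Q_normal)
  have "commutator G (commutator G y x) g \<in> Q (i + 2)" if "g \<in> carrier G" for g
    using commutator_mem_Q_Suc[OF commutator_mem_Q_Suc[OF assms(2,1)] that] by simp
  then show ?thesis
    using assms Q_closed by (intro M.rcos_pow_mult) blast+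
qed

text \<open>
  Under the first assumption \<open>p\<close>-th powers are multiplicative on \<open>Q i\<close> modulo \<open>Q (i + 2)\<close>, so the
  elements congruent to such powers form a subgroup. The second assumption puts the commutators
  among the generators of \<open>Q (i + 1)\<close> into this subgroup.
\<close>

lemma Q_Suc_eq_powers:
  assumes pow_comm: "\<And>y g. y \<in> Q i \<Longrightarrow> g \<in> carrier G \<Longrightarrow>
      commutator G y g [^] (p choose 2) \<in> Q (i + 2)"
    and comm_pow: "\<And>x g. x \<in> Q i \<Longrightarrow> g \<in> carrier G \<Longrightarrow>
      commutator G x g \<in> generate G ((\<lambda>y. y [^] p) ` Q i \<union> Q (i + 2))"
    and x: "x \<in> Q (Suc i)"
  shows "\<exists>y\<in>Q i. Q (i + 2) #> x = Q (i + 2) #> y [^] p"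
proof -
  interpret Qi: normal "Q i" G by (rule Q_normal)
  interpret M: normal "Q (i + 2)" G by (rule Q_normal)
  define S where "S = {x \<in> carrier G. \<exists>y\<in>Q i. Q (i + 2) #> x = Q (i + 2) #> y [^] p}"
  have "subgroup S G"
  proof (rule subgroupI)
    show "S \<subseteq> carrier G" by (auto simp: S_def)
    show "S \<noteq> {}" by (auto simp: S_def intro!: exI[of _ \<one>] bexI[of _ \<one>])
    fix a assume "a \<in> S"
    then obtain y where a: "a \<in> carrier G" "y \<in> Q i" "Q (i + 2) #> a = Q (i + 2) #> y [^] p"
      by (auto simp: S_def)
    have y: "y \<in> carrier G" using a Q_closed by blast
    have "Q (i + 2) #> inv a = Q (i + 2) #> (inv y) [^] p"
      using M.rcos_inv[of a] M.rcos_inv[of "y [^] p"] a y by (simp add: nat_pow_inv)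
    then show "inv a \<in> S"
      using a by (auto simp: S_def)
    fix b assume "b \<in> S"
    then obtain z where b: "b \<in> carrier G" "z \<in> Q i" "Q (i + 2) #> b = Q (i + 2) #> z [^] p"
      by (auto simp: S_def)
    have z: "z \<in> carrier G" using b Q_closed by blast
    have "Q (i + 2) #> (a \<otimes> b) = Q (i + 2) #> (y [^] p \<otimes> z [^] p)"
      using a b y z by (intro M.rcos_mult_eq) auto
    also have "\<dots> = Q (i + 2) #> (y \<otimes> z) [^] p"
      using rcos_Q_pow_mult[of y z i] pow_comm b y by simp
    finally show "a \<otimes> b \<in> S"
      using a b unfolding S_def by auto
  qed
  moreover have M_sub: "Q (i + 2) \<subseteq> S"
  proof
    fix x assume "x \<in> Q (i + 2)"
    then have "x \<in> carrier G" "Q (i + 2) #> x = Q (i + 2) #> \<one> [^] p"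
      using M.subset M.rcos_eq_self_iff by auto
    then show "x \<in> S"
      unfolding S_def using Qi.one_closed by (intro CollectI conjI bexI[of _ \<one>])
  qed
  moreover have pow_sub: "y [^] p \<in> S" if "y \<in> Q i" for y
    using that Q_closed by (auto simp: S_def)
  moreover have "generate G ((\<lambda>y. y [^] p) ` Q i \<union> Q (i + 2)) \<subseteq> S"
    by (rule generate_subgroup_incl) (use \<open>subgroup S G\<close> M_sub pow_sub in blast)+
  ultimately have "Q (Suc i) \<subseteq> S"
    using N_subset_Q comm_pow by (intro Q_Suc_subset_subgroup) blast+
  then show ?thesis using x by (auto simp: S_def)
qed

text \<open>
  Conjugation by \<open>g\<close> replaces \<open>x\<close> by \<open>x [x, g]\<close> and hence \<open>x\<^sup>p\<close> by the \<open>p\<close>-th power of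
  \<open>x [x, g]\<close>, which splits modulo \<open>Q (i + 2)\<close>.
\<close>

lemma rcos_commutator_pow:
  assumes x: "x \<in> carrier G" "commutator G x g \<in> Q i" and g: "g \<in> carrier G"
    and "commutator G (commutator G x g) x [^] (p choose 2) \<in> Q (i + 2)"
  shows "Q (i + 2) #> commutator G (x [^] p) g = Q (i + 2) #> commutator G x g [^] p"
proof -
  interpret M: normal "Q (i + 2)" G by (rule Q_normal)
  let ?c = "commutator G x g"
  have xc: "x \<otimes> ?c = inv g \<otimes> x \<otimes> g"
    using x g by (simp add: commutator_def m_assoc inv_mult_cancel)
  have "Q (i + 2) #> (x \<otimes> ?c) [^] p = Q (i + 2) #> (x [^] p \<otimes> ?c [^] p)"
    using assms by (intro rcos_Q_pow_mult)
  moreover have "(x \<otimes> ?c) [^] p = inv g \<otimes> x [^] p \<otimes> g"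
    using x g pow_conj[of "inv g" x p] by (simp add: xc)
  ultimately have "Q (i + 2) #> (inv (x [^] p) \<otimes> (inv g \<otimes> x [^] p \<otimes> g))
      = Q (i + 2) #> (inv (x [^] p) \<otimes> (x [^] p \<otimes> ?c [^] p))"
    using x g by - (rule M.rcos_mult_eq, simp_all)
  then show ?thesis
    using x g by (simp add: commutator_def m_assoc inv_mult_cancel)
qed

text \<open>
  The factor \<open>z\<close> is central modulo \<open>Q (i + 1)\<close>.
\<close>

lemma rcos_commutator_mult:
  assumes "x \<in> carrier G" "z \<in> Q i" "g \<in> carrier G"
  shows "Q (Suc i) #> commutator G (x \<otimes> z) g = Q (Suc i) #> commutator G x g"
proof -
  interpret M: normal "Q (Suc i)" G by (rule Q_normal)
  let ?c = "commutator G x g"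
  have z: "z \<in> carrier G" using assms Q_closed by blast
  have "commutator G (x \<otimes> z) g = ?c \<otimes> (inv (commutator G z ?c) \<otimes> commutator G z g)"
    using assms(1,3) z by (simp add: commutator_def m_assoc inv_mult_group inv_mult_cancel)
  moreover have "inv (commutator G z ?c) \<otimes> commutator G z g \<in> Q (Suc i)"
    using assms commutator_mem_Q_Suc by (intro M.m_closed M.m_inv_closed) auto
  ultimately show ?thesis
    using assms by (simp add: M.rcos_mult_mem)
qed

lemma Q_nat_pow_closed: "x \<in> Q i \<Longrightarrow> x [^] (n :: nat) \<in> Q i"
  using Q_normal normal_imp_subgroup subgroup_nat_pow_closed by blast

lemma pow_choose_2_mem_Q_Suc:
  assumes "p \<noteq> 2" "c \<in> Q i"
  shows "c [^] (p choose 2) \<in> Q (Suc i)"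
proof -
  have "p dvd p choose 2"
    using assms prime prime_ge_2_nat[OF prime] by (intro dvd_choose_prime) auto
  then obtain k where "p choose 2 = p * k" by (rule dvdE)
  then show ?thesis
    using assms Q_closed Q_nat_pow_closed[OF pow_mem_Q_Suc[OF assms(2)], of k]
    by (simp add: nat_pow_pow)
qed

text \<open>
  The key property of powerful groups: \<open>x \<mapsto> x\<^sup>p\<close> induces a homomorphism from \<open>Q i / Q (i + 1)\<close> to
  \<open>Q (i + 1) / Q (i + 2)\<close>, by the first part, and this homomorphism is surjective, by the second.
  The two parts support each other in an induction on \<open>i\<close>. An element of \<open>Q (i + 1)\<close> is some \<open>y\<^sup>p\<close>
  with \<open>y \<in> Q i\<close> up to a factor in \<open>Q (i + 2)\<close>, so its commutator with \<open>g\<close> is \<open>[y, g]\<^sup>p\<close> modulo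
  \<open>Q (i + 3)\<close>, and this is again a \<open>p\<close>-th power of an element of \<open>Q (i + 1)\<close>. For odd \<open>p\<close> the first
  part is immediate, since \<open>p\<close> divides the exponent. For \<open>p = 2\<close> the exponent is \<open>1\<close> and the claim is
  that commutators with \<open>Q i\<close> drop by two steps; this starts from the hypothesis on fourth powers.
\<close>

lemma Q_powerful:
  shows "x \<in> Q i \<Longrightarrow> g \<in> carrier G \<Longrightarrow> commutator G x g [^] (p choose 2) \<in> Q (i + 2)" (is "_ \<Longrightarrow> _ \<Longrightarrow> ?P i x g")
    and "x \<in> Q (Suc i) \<Longrightarrow> \<exists>y\<in>Q i. Q (i + 2) #> x = Q (i + 2) #> y [^] p"
proof -
  have odd_case: "commutator G x g [^] (p choose 2) \<in> Q (i + 2)"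
    if "x \<in> Q i" "g \<in> carrier G" "p \<noteq> 2" for x g i
    using pow_choose_2_mem_Q_Suc[OF that(3) commutator_mem_Q_Suc[OF that(1,2)]] by simp
  have "(\<forall>x\<in>Q i. \<forall>g\<in>carrier G. commutator G x g [^] (p choose 2) \<in> Q (i + 2)) \<and>
    (\<forall>x\<in>Q (Suc i). \<exists>y\<in>Q i. Q (i + 2) #> x = Q (i + 2) #> y [^] p)" for i
  proof (induction i)
    case 0
    have Q2: "subgroup (Q 2) G" using Q_normal normal_imp_subgroup by blast
    have two: "commutator G x g \<in> Q 2" if "x \<in> carrier G" "g \<in> carrier G" "p = 2" for x g
    proof -
      have "y [^] (4::nat) \<in> Q 2" if "y \<in> carrier G" for y
        using pow_pow_mem_Q[OF that, of 2] \<open>p = 2\<close> by simp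
      then have "generate G ((\<lambda>y. y [^] (4::nat)) ` carrier G \<union> N) \<subseteq> Q 2"
        using N_subset_Q Q2 by (intro generate_subgroup_incl) auto
      then show ?thesis using powerful[OF that(1,2)] \<open>p = 2\<close> by auto
    qed
    have comm: "commutator G x g [^] (p choose 2) \<in> Q 2" if "x \<in> carrier G" "g \<in> carrier G" for x g
      using two[OF that] odd_case[of x 0 g] that by (cases "p = 2") (auto simp: numeral_2_eq_2)
    have "commutator G x g \<in> generate G ((\<lambda>y. y [^] p) ` carrier G \<union> Q 2)"
      if "x \<in> carrier G" "g \<in> carrier G" for x g
    proof (cases "p = 2")
      case True
      then show ?thesis using two[OF that] by (auto intro: generate.incl)
    next
      case False
      then show ?thesis
        using powerful[OF that] mono_generate[of "(\<lambda>y. y [^] p) ` carrier G \<union> N" 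
            "(\<lambda>y. y [^] p) ` carrier G \<union> Q 2"] N_subset_Q by auto
    qed
    then show ?case
      using comm Q_Suc_eq_powers[of 0] by (auto simp: numeral_2_eq_2)
  next
    case (Suc i)
    interpret M: normal "Q (Suc i + 2)" G by (rule Q_normal)
    have root: "\<exists>c\<in>Q (Suc i). (p = 2 \<longrightarrow> c \<in> Q (i + 2)) \<and>
        Q (Suc i + 2) #> commutator G x g = Q (Suc i + 2) #> c [^] p"
      if x: "x \<in> Q (Suc i)" and g: "g \<in> carrier G" for x g
    proof -
      interpret L: normal "Q (i + 2)" G by (rule Q_normal)
      obtain y where y: "y \<in> Q i" "Q (i + 2) #> x = Q (i + 2) #> y [^] p"
        using Suc x by blast
      have carr: "x \<in> carrier G" "y \<in> carrier G" using x y Q_closed by blast+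
      define z where "z = inv (y [^] p) \<otimes> x"
      let ?c = "commutator G y g"
      have xz: "x = y [^] p \<otimes> z"
        using carr by (simp add: z_def inv_mult_cancel)
      have z: "z \<in> Q (i + 2)"
        using y(2) carr L.rcos_eq_iff_left[of x "y [^] p"] unfolding z_def by blast
      have c: "?c \<in> Q (Suc i)"
        using y(1) g by (rule commutator_mem_Q_Suc)
      \<comment> \<open>For \<open>p = 2\<close> the exponent in the induction hypothesis is \<open>1\<close>.\<close>
      have c2: "?c \<in> Q (i + 2)" if "p = 2"
      proof -
        have "?c [^] (p choose 2) \<in> Q (i + 2)"
          using Suc y(1) g by blast
        then show ?thesis using that carr g by simp
      qed
      have "commutator G ?c y [^] (p choose 2) \<in> Q (Suc i + 2)"
      proof (cases "p = 2")
        case True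
        then show ?thesis
          using commutator_mem_Q_Suc[OF c2 carr(2)] carr g by simp
      next
        case False
        then show ?thesis using odd_case c carr by blast
      qed
      then have "Q (Suc i + 2) #> commutator G (y [^] p) g = Q (Suc i + 2) #> ?c [^] p"
        using carr g c by (intro rcos_commutator_pow)
      moreover have "Q (Suc i + 2) #> commutator G x g = Q (Suc i + 2) #> commutator G (y [^] p) g"
        using rcos_commutator_mult[OF _ z g, of "y [^] p"] carr xz by simp
      ultimately show ?thesis using c c2 by blast
    qed
    have comm: "commutator G x g [^] (p choose 2) \<in> Q (Suc i + 2)"
      if x: "x \<in> Q (Suc i)" and g: "g \<in> carrier G" for x g
    proof (cases "p = 2")
      case True
      obtain c where c: "c \<in> Q (i + 2)" "Q (Suc i + 2) #> commutator G x g = Q (Suc i + 2) #> c [^] p"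
        using root x g True by blast
      have "c [^] p \<in> Q (Suc i + 2)"
        using pow_mem_Q_Suc[OF c(1)] by simp
      then have "commutator G x g \<in> Q (Suc i + 2)"
        using c x g Q_closed M.rcos_eq_self_iff by (metis commutator_closed nat_pow_closed)
      then show ?thesis using True x g Q_closed by simp
    qed (use odd_case that in blast)
    moreover have "commutator G x g \<in> generate G ((\<lambda>y. y [^] p) ` Q (Suc i) \<union> Q (Suc i + 2))"
      if x: "x \<in> Q (Suc i)" and g: "g \<in> carrier G" for x g
    proof -
      obtain c where c: "c \<in> Q (Suc i)" "Q (Suc i + 2) #> commutator G x g = Q (Suc i + 2) #> c [^] p"
        using root x g by blast
      have carr: "x \<in> carrier G" "c \<in> carrier G" using x c Q_closed by blast+
      have "commutator G x g \<otimes> inv (c [^] p) \<in> Q (Suc i + 2)"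
        using c(2) carr g M.rcos_eq_iff[of "commutator G x g" "c [^] p"] by blast
      then have "commutator G x g \<otimes> inv (c [^] p) \<otimes> c [^] p
          \<in> generate G ((\<lambda>y. y [^] p) ` Q (Suc i) \<union> Q (Suc i + 2))"
        using c by (intro generate.eng generate.incl) blast+
      then show ?thesis using carr g by (simp add: m_assoc)
    qed
    ultimately show ?case
      using Q_Suc_eq_powers[of "Suc i"] by blast
  qed
  then show "x \<in> Q i \<Longrightarrow> g \<in> carrier G \<Longrightarrow> ?P i x g"
    and "x \<in> Q (Suc i) \<Longrightarrow> \<exists>y\<in>Q i. Q (i + 2) #> x = Q (i + 2) #> y [^] p"
    by blast+
qed

end

section \<open>Ordered products of powers of generators\<close>

primrec ordered_prod :: "('a, 'b) monoid_scheme \<Rightarrow> 'i list \<Rightarrow> ('i \<Rightarrow> 'a) \<Rightarrow> 'a" where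
  "ordered_prod G [] a = \<one>\<^bsub>G\<^esub>"
| "ordered_prod G (i # is) a = a i \<otimes>\<^bsub>G\<^esub> ordered_prod G is a"

context group begin

lemma ordered_prod_closed [simp, intro]:
  "(\<And>i. i \<in> set is \<Longrightarrow> a i \<in> carrier G) \<Longrightarrow> ordered_prod G is a \<in> carrier G"
  by (induction "is") auto

lemma ordered_prod_one: "(\<And>i. i \<in> set is \<Longrightarrow> a i = \<one>) \<Longrightarrow> ordered_prod G is a = \<one>"
  by (induction "is") auto

lemma ordered_prod_cong:
  "(\<And>i. i \<in> set is \<Longrightarrow> a i = b i) \<Longrightarrow> ordered_prod G is a = ordered_prod G is b"
  by (induction "is") auto

lemma ordered_prod_single:
  assumes "distinct is" "i \<in> set is" "x \<in> carrier G"
  shows "ordered_prod G is (\<lambda>j. if j = i then x else \<one>) = x"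
  using assms
proof (induction "is")
  case (Cons j js)
  then show ?case
    by (cases "j = i") (auto intro!: ordered_prod_one)
qed simp

lemma ordered_prod_mem_subgroup:
  "subgroup S G \<Longrightarrow> (\<And>i. i \<in> set is \<Longrightarrow> a i \<in> S) \<Longrightarrow> ordered_prod G is a \<in> S"
  by (induction "is") (auto simp: subgroup.one_closed subgroup.m_closed)

end

text \<open>
  Each \<open>b i\<close> is central modulo \<open>H\<close>, so it can be moved next to \<open>a i\<close>.
\<close>

lemma (in normal) rcos_ordered_prod_mult:
  assumes "\<And>i. i \<in> set is \<Longrightarrow> a i \<in> carrier G" "\<And>i. i \<in> set is \<Longrightarrow> b i \<in> carrier G"
    and "\<And>i g. i \<in> set is \<Longrightarrow> g \<in> carrier G \<Longrightarrow> commutator G (b i) g \<in> H"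
  shows "H #> (ordered_prod G is a \<otimes> ordered_prod G is b)
       = H #> ordered_prod G is (\<lambda>i. a i \<otimes> b i)"
  using assms
proof (induction "is")
  case (Cons i "is")
  let ?A = "ordered_prod G is a" and ?B = "ordered_prod G is b"
  have carr: "a i \<in> carrier G" "b i \<in> carrier G" "?A \<in> carrier G" "?B \<in> carrier G"
    using Cons by auto
  have "H #> (b i \<otimes> ?A) = H #> (?A \<otimes> b i)"
    using Cons carr commutator_mem_iff by auto
  then have "H #> (a i \<otimes> ((?A \<otimes> b i) \<otimes> ?B)) = H #> (a i \<otimes> ((b i \<otimes> ?A) \<otimes> ?B))"
    using carr by (intro rcos_mult_eq[OF refl rcos_mult_eq[OF _ refl]]) simp_all
  also have "\<dots> = H #> ((a i \<otimes> b i) \<otimes> (?A \<otimes> ?B))"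
    using carr by (simp add: m_assoc)
  also have "\<dots> = H #> ((a i \<otimes> b i) \<otimes> ordered_prod G is (\<lambda>i. a i \<otimes> b i))"
    by (rule rcos_mult_eq) (use Cons carr in auto)
  finally show ?case
    using carr by (simp add: m_assoc)
qed simp

lemma (in normal) rcos_ordered_prod_cong:
  assumes "\<And>i. i \<in> set is \<Longrightarrow> a i \<in> carrier G" "\<And>i. i \<in> set is \<Longrightarrow> b i \<in> carrier G"
    and "\<And>i. i \<in> set is \<Longrightarrow> H #> a i = H #> b i"
  shows "H #> ordered_prod G is a = H #> ordered_prod G is b"
  using assms
proof (induction "is")
  case (Cons i "is")
  have "H #> (a i \<otimes> ordered_prod G is a) = H #> (b i \<otimes> ordered_prod G is b)"
    by (rule rcos_mult_eq) (use Cons in auto)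
  then show ?case by simp
qed simp

locale powerful_modulo_generated = powerful_modulo +
  fixes gs :: "'a list"
  assumes distinct_gs: "distinct gs" and gs_closed: "set gs \<subseteq> carrier G"
    and generated: "carrier G \<subseteq> generate G (set gs \<union> N)"
begin

lemma gs_mem [simp]: "g \<in> set gs \<Longrightarrow> g \<in> carrier G"
  using gs_closed by blast

lemma pow_mult_mem_Q: "x \<in> carrier G \<Longrightarrow> x [^] (p ^ n * k) \<in> Q n"
  using Q_nat_pow_closed[OF pow_pow_mem_Q, of x n k] by (simp add: nat_pow_pow)

text \<open>
  Modulo \<open>Q 1\<close> the group is abelian of exponent \<open>p\<close>, so the ordered products are closed under
  multiplication, and an inverse is the power with exponent \<open>p - 1\<close>.
\<close>

lemma Q_0_ordered_prod:
  assumes "x \<in> carrier G"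
  shows "\<exists>e :: 'a \<Rightarrow> nat. Q 1 #> x = Q 1 #> ordered_prod G gs (\<lambda>g. g [^] e g)"
proof -
  interpret M: normal "Q 1" G by (rule Q_normal)
  define S where "S = {x \<in> carrier G. \<exists>e :: 'a \<Rightarrow> nat. Q 1 #> x = Q 1 #> ordered_prod G gs (\<lambda>g. g [^] e g)}"
  have S_Q: "x \<in> S" if "x \<in> Q 1" for x
  proof -
    have "x \<in> carrier G" "Q 1 #> x = Q 1 #> ordered_prod G gs (\<lambda>g. g [^] (0 :: nat))"
      using that M.rcos_eq_self_iff M.subset by (auto simp: ordered_prod_one)
    then show ?thesis
      unfolding S_def by (intro CollectI conjI exI[of _ "\<lambda>_. 0"])
  qed
  have S_mult: "x \<otimes> y \<in> S" if xy: "x \<in> S" "y \<in> S" for x y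
  proof -
    obtain e f :: "'a \<Rightarrow> nat" where
      x: "x \<in> carrier G" "Q 1 #> x = Q 1 #> ordered_prod G gs (\<lambda>g. g [^] e g)" and
      y: "y \<in> carrier G" "Q 1 #> y = Q 1 #> ordered_prod G gs (\<lambda>g. g [^] f g)"
      using xy by (auto simp: S_def)
    have "Q 1 #> (x \<otimes> y)
        = Q 1 #> (ordered_prod G gs (\<lambda>g. g [^] e g) \<otimes> ordered_prod G gs (\<lambda>g. g [^] f g))"
      using x y by (intro M.rcos_mult_eq) auto
    also have "\<dots> = Q 1 #> ordered_prod G gs (\<lambda>g. g [^] e g \<otimes> g [^] f g)"
      using commutator_mem_Q_Suc[of _ 0] by (intro M.rcos_ordered_prod_mult) auto
    also have "ordered_prod G gs (\<lambda>g. g [^] e g \<otimes> g [^] f g) = ordered_prod G gs (\<lambda>g. g [^] (e g + f g))"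
      by (rule ordered_prod_cong) (simp add: nat_pow_mult)
    finally show ?thesis using x y by (auto simp: S_def)
  qed
  have "subgroup S G"
  proof (rule subgroupI)
    show "S \<subseteq> carrier G" by (auto simp: S_def)
    show "S \<noteq> {}" using S_Q[OF M.one_closed] by blast
    fix x assume x: "x \<in> S"
    then have x_carr: "x \<in> carrier G" by (auto simp: S_def)
    have pow: "x [^] n \<in> S" for n :: nat
      by (induction n) (auto simp: S_Q[OF M.one_closed] S_mult x)
    have "x [^] (p - 1) \<otimes> x \<in> Q 1"
      using pow_mem_Q_Suc[of x 0] x_carr prime_gt_0_nat[OF prime] nat_pow_Suc[of x "p - 1"]
      by simp
    then have "Q 1 #> inv x = Q 1 #> x [^] (p - 1)"
      using x_carr M.rcos_eq_iff[of "x [^] (p - 1)" "inv x"] by simp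
    then show "inv x \<in> S"
      using pow[of "p - 1"] x_carr by (auto simp: S_def)
  qed (use S_mult in auto)
  moreover have "set gs \<subseteq> S"
  proof
    fix g assume g: "g \<in> set gs"
    have "(\<lambda>h. h [^] (if h = g then 1 else 0 :: nat)) = (\<lambda>h. if h = g then g else \<one>)"
      using g by (auto simp: fun_eq_iff)
    then have "ordered_prod G gs (\<lambda>h. h [^] (if h = g then 1 else 0 :: nat)) = g"
      using g ordered_prod_single[OF distinct_gs g, of g] by simp
    then show "g \<in> S"
      using g by (auto simp: S_def intro!: exI[of _ "\<lambda>h. if h = g then 1 else 0"])
  qed
  ultimately have "generate G (set gs \<union> N) \<subseteq> S"
    using S_Q N_subset_Q by (intro generate_subgroup_incl) blast+
  then show ?thesis
    using generated assms unfolding S_def by blast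
qed

lemma Q_ordered_prod_pow:
  assumes "set hs \<subseteq> set gs"
  shows "Q (n + 2) #> ordered_prod G hs (\<lambda>g. g [^] (p ^ n * e g)) [^] p
       = Q (n + 2) #> ordered_prod G hs (\<lambda>g. g [^] (p ^ Suc n * e g))"
  using assms
proof (induction hs)
  case (Cons h hs)
  interpret M: normal "Q (n + 2)" G by (rule Q_normal)
  let ?P = "\<lambda>n. ordered_prod G hs (\<lambda>g. g [^] (p ^ n * e g))"
  have carr: "h \<in> carrier G" "?P n \<in> carrier G" for n
    using Cons.prems by (auto intro!: ordered_prod_closed)
  have "?P n \<in> Q n"
    using Q_normal[of n] Cons pow_mult_mem_Q
    by (intro ordered_prod_mem_subgroup) (auto simp: normal_imp_subgroup)
  then have "Q (n + 2) #> (h [^] (p ^ n * e h) \<otimes> ?P n) [^] p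
      = Q (n + 2) #> ((h [^] (p ^ n * e h)) [^] p \<otimes> ?P n [^] p)"
    using carr Q_powerful(1) by (intro rcos_Q_pow_mult) auto
  also have "\<dots> = Q (n + 2) #> (h [^] (p ^ Suc n * e h) \<otimes> ?P (Suc n))"
  proof (rule M.rcos_mult_eq)
    show "Q (n + 2) #> (h [^] (p ^ n * e h)) [^] p = Q (n + 2) #> h [^] (p ^ Suc n * e h)"
      using carr by (simp add: nat_pow_pow ac_simps)
    show "Q (n + 2) #> ?P n [^] p = Q (n + 2) #> ?P (Suc n)"
      using Cons by simp
  qed (use carr(1) carr(2)[of n] carr(2)[of "Suc n"] in simp_all)
  finally show ?case by simp
qed simp

text \<open>
  By \<open>Q_powerful\<close> an expression for an element of \<open>Q (n + 1)\<close> arises by raising one for an element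
  of \<open>Q n\<close> to the \<open>p\<close>-th power.
\<close>

lemma Q_ordered_prod_Suc:
  "x \<in> Q n \<Longrightarrow> \<exists>e. Q (Suc n) #> x = Q (Suc n) #> ordered_prod G gs (\<lambda>g. g [^] (p ^ n * e g))"
proof (induction n arbitrary: x)
  case 0
  then show ?case using Q_0_ordered_prod by simp
next
  case (Suc n)
  interpret M: normal "Q (n + 2)" G by (rule Q_normal)
  interpret L: normal "Q (Suc n)" G by (rule Q_normal)
  obtain y where y: "y \<in> Q n" "Q (n + 2) #> x = Q (n + 2) #> y [^] p"
    using Q_powerful(2) Suc.prems by blast
  obtain e where e: "Q (Suc n) #> y = Q (Suc n) #> ordered_prod G gs (\<lambda>g. g [^] (p ^ n * e g))"
    using Suc.IH y by blast
  let ?P = "\<lambda>n. ordered_prod G gs (\<lambda>g. g [^] (p ^ n * e g))"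
  define z where "z = inv (?P n) \<otimes> y"
  have carr: "y \<in> carrier G" "?P k \<in> carrier G" for k
    using y Q_closed by auto
  have z: "z \<in> Q (Suc n)"
    using L.rcos_eq_iff_left[OF carr] e unfolding z_def by blast
  have yz: "y = ?P n \<otimes> z"
    using carr by (simp add: z_def inv_mult_cancel)
  have "z \<in> Q n"
    using z Q_antimono[of n "Suc n"] by auto
  then have "Q (n + 2) #> y [^] p = Q (n + 2) #> (?P n [^] p \<otimes> z [^] p)"
    unfolding yz using carr Q_powerful(1) by (intro rcos_Q_pow_mult) auto
  also have "\<dots> = Q (n + 2) #> ?P n [^] p"
    using pow_mem_Q_Suc[OF z] carr by (intro M.rcos_mult_mem) auto
  also have "\<dots> = Q (n + 2) #> ?P (Suc n)"
    by (rule Q_ordered_prod_pow) simp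
  finally show ?case using y by auto
qed

text \<open>
  Successive approximation: the error at stage \<open>l\<close> is an ordered product of powers with exponents
  divisible by \<open>p\<^sup>l\<close>, which are central modulo \<open>Q (l + 1)\<close> and can be absorbed into the exponents
  found so far.
\<close>

lemma Q_ordered_prod:
  assumes "x \<in> Q n" "n \<le> l"
  shows "\<exists>e. Q l #> x = Q l #> ordered_prod G gs (\<lambda>g. g [^] (p ^ n * e g))"
  using assms(2)
proof (induction l rule: dec_induct)
  case base
  interpret M: normal "Q n" G by (rule Q_normal)
  show ?case
    using M.rcos_eq_self_iff[of x] assms M.subset
    by (auto simp: ordered_prod_one intro!: exI[of _ "\<lambda>_. 0"])
next
  case (step l)
  interpret L: normal "Q l" G by (rule Q_normal)
  interpret M: normal "Q (Suc l)" G by (rule Q_normal)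
  obtain e where e: "Q l #> x = Q l #> ordered_prod G gs (\<lambda>g. g [^] (p ^ n * e g))"
    using step by blast
  let ?P = "ordered_prod G gs (\<lambda>g. g [^] (p ^ n * e g))"
  define z where "z = inv ?P \<otimes> x"
  have carr: "x \<in> carrier G" "?P \<in> carrier G"
    using assms Q_closed by auto
  have z: "z \<in> Q l"
    using L.rcos_eq_iff_left[OF carr] e unfolding z_def by blast
  have xz: "x = ?P \<otimes> z"
    using carr by (simp add: z_def inv_mult_cancel)
  obtain f where f: "Q (Suc l) #> z = Q (Suc l) #> ordered_prod G gs (\<lambda>g. g [^] (p ^ l * f g))"
    using Q_ordered_prod_Suc z by blast
  have "Q (Suc l) #> (?P \<otimes> z) = Q (Suc l) #> (?P \<otimes> ordered_prod G gs (\<lambda>g. g [^] (p ^ l * f g)))"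
    using L.mem_carrier[OF z] f by (intro M.rcos_mult_eq) auto
  also have "\<dots> = Q (Suc l) #> ordered_prod G gs (\<lambda>g. g [^] (p ^ n * e g) \<otimes> g [^] (p ^ l * f g))"
    using commutator_mem_Q_Suc[OF pow_mult_mem_Q] by (intro M.rcos_ordered_prod_mult) auto
  also have "ordered_prod G gs (\<lambda>g. g [^] (p ^ n * e g) \<otimes> g [^] (p ^ l * f g))
      = ordered_prod G gs (\<lambda>g. g [^] (p ^ n * (e g + p ^ (l - n) * f g)))"
    using step by (intro ordered_prod_cong)
      (simp add: nat_pow_mult algebra_simps flip: power_add)
  finally show ?case unfolding xz[symmetric] by (rule exI[of _ "\<lambda>g. e g + p ^ (l - n) * f g"])
qed

end

section \<open>Nilpotency of finite \<open>p\<close>-groups\<close>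

text \<open>
  Conjugacy classes have \<open>p\<close>-power size. If \<open>{1}\<close> were the only class with one element, the order of
  \<open>G\<close> would be \<open>1\<close> modulo \<open>p\<close>.
\<close>

lemma (in group) prime_power_order_center:
  assumes p: "Factorial_Ring.prime (p::nat)" and card: "order G = p ^ k" and "k > 0"
  shows "\<exists>x\<in>carrier G. x \<noteq> \<one> \<and> (\<forall>y\<in>carrier G. y \<otimes> x = x \<otimes> y)"
proof (rule ccontr)
  assume contr: "\<not> ?thesis"
  define \<phi> where "\<phi> = (\<lambda>g. \<lambda>h \<in> carrier G. g \<otimes> h \<otimes> inv g)"
  interpret act: group_action G "carrier G" \<phi>
    unfolding \<phi>_def by (rule action_by_conjugation)
  have fin: "finite (carrier G)"
    using card p order_gt_0_iff_finite by (simp add: prime_gt_0_nat)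
  have one: "orbit G \<phi> \<one> = {\<one>}"
    by (auto simp: orbit_def \<phi>_def intro: exI[of _ \<one>])
  have dvd: "p dvd card A" if A: "A \<in> orbits G (carrier G) \<phi>" "A \<noteq> {\<one>}" for A
  proof -
    obtain x where x: "x \<in> carrier G" "A = orbit G \<phi> x"
      using A unfolding orbits_def by blast
    then have "x \<noteq> \<one>"
      using A one by auto
    then obtain y where y: "y \<in> carrier G" "y \<otimes> x \<noteq> x \<otimes> y"
      using contr x by blast
    have "card A dvd p ^ k"
      using act.orbit_stabilizer_theorem[OF x(1)] card x(2) by (metis dvd_triv_left)
    then obtain j where j: "card A = p ^ j"
      using divides_primepow_nat p by blast
    have "{x, \<phi> y x} \<subseteq> A"
      using act.orbit_refl[OF x(1)] x y by (auto simp: orbit_def)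
    moreover have "\<phi> y x \<noteq> x"
      using x y by (auto simp: \<phi>_def inv_solve_right')
    moreover have "finite A"
      using fin x by (auto simp: orbit_def)
    ultimately have "card A \<noteq> 1"
      by (metis card_1_singletonE insert_subset singletonD)
    then show ?thesis
      using j by (cases j) auto
  qed
  have orb1: "{\<one>} \<in> orbits G (carrier G) \<phi>"
    using one by (auto simp: orbits_def intro!: exI[of _ \<one>])
  have fin_orb: "finite (orbits G (carrier G) \<phi>)"
    using fin by (simp add: orbits_def setcompr_eq_image)
  have "card (carrier G) = (\<Sum>A\<in>orbits G (carrier G) \<phi>. card A)"
    using act.disjoint_sum[OF fin, of "\<lambda>_. 1 :: nat"] by simp
  also have "\<dots> = 1 + (\<Sum>A\<in>orbits G (carrier G) \<phi> - {{\<one>}}. card A)"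
    using sum.remove[OF fin_orb orb1, of card] by simp
  finally have "order G = 1 + (\<Sum>A\<in>orbits G (carrier G) \<phi> - {{\<one>}}. card A)"
    by (simp add: order_def)
  moreover have "p dvd (\<Sum>A\<in>orbits G (carrier G) \<phi> - {{\<one>}}. card A)"
    by (rule dvd_sum) (use dvd in auto)
  moreover have "p dvd order G"
    using card \<open>k > 0\<close> by simp
  ultimately have "p dvd 1"
    by (metis dvd_add_left_iff)
  then show False
    using p by simp
qed

context normal begin

text \<open>
  This is the preimage in \<open>G\<close> of the elements of the centre of \<open>G / H\<close> whose \<open>n\<close>-th power is
  trivial.
\<close>

definition central_socle :: "nat \<Rightarrow> 'a set" where
  "central_socle n = {y \<in> carrier G. y [^] n \<in> H \<and> (\<forall>g\<in>carrier G. commutator G y g \<in> H)}"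

lemma subset_central_socle: "H \<subseteq> central_socle n"
  using commutator_mem subgroup_nat_pow_closed[OF is_subgroup] by (auto simp: central_socle_def)

lemma central_socle_normal: "central_socle n \<lhd> G"
proof (rule normal_invI)
  have comm: "H #> (y \<otimes> g) = H #> (g \<otimes> y)" if "y \<in> central_socle n" "g \<in> carrier G" for y g
    using that by (auto simp: central_socle_def commutator_mem_iff)
  show "subgroup (central_socle n) G"
  proof (rule subgroupI)
    show "central_socle n \<subseteq> carrier G" by (auto simp: central_socle_def)
    show "central_socle n \<noteq> {}" 
      by (metis empty_iff is_subgroup subgroup.one_closed subset_central_socle subsetD)
    fix y assume y: "y \<in> central_socle n"
    then have yc: "y \<in> carrier G" by (simp add: central_socle_def)
    have "inv y [^] n \<in> H"
      using y by (simp add: central_socle_def nat_pow_inv)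
    moreover have "commutator G (inv y) g \<in> H" if g: "g \<in> carrier G" for g
    proof -
      have "H #> (inv y \<otimes> (g \<otimes> y) \<otimes> inv y) = H #> (inv y \<otimes> (y \<otimes> g) \<otimes> inv y)"
        using yc g by (intro rcos_mult_eq[OF rcos_mult_eq[OF refl comm[OF y g, symmetric]] refl]) simp_all
      then show ?thesis
        using yc g by (simp add: commutator_mem_iff m_assoc inv_mult_cancel)
    qed
    ultimately show "inv y \<in> central_socle n"
      using yc by (simp add: central_socle_def)
    fix z assume z: "z \<in> central_socle n"
    then have zc: "z \<in> carrier G" by (simp add: central_socle_def)
    have "commutator G z y \<in> H"
      using z yc by (simp add: central_socle_def)
    then have "H #> (y \<otimes> z) [^] n = H #> (y [^] n \<otimes> z [^] n)"
      using yc zc subgroup_nat_pow_closed[OF is_subgroup]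
      by (intro rcos_pow_mult) (simp_all add: commutator_mem)
    moreover have "y [^] n \<otimes> z [^] n \<in> H"
      using y z by (simp add: central_socle_def)
    ultimately have "(y \<otimes> z) [^] n \<in> H"
      using yc zc rcos_eq_self_iff by (metis m_closed nat_pow_closed)
    moreover have "commutator G (y \<otimes> z) g \<in> H" if g: "g \<in> carrier G" for g
    proof -
      have "H #> (y \<otimes> z \<otimes> g) = H #> (y \<otimes> (z \<otimes> g))" using g yc zc by (simp add: m_assoc)
      also have "\<dots> = H #> (y \<otimes> (g \<otimes> z))"
        using g yc zc by (intro rcos_mult_eq[OF refl comm[OF z g]]) simp_all
      also have "\<dots> = H #> (y \<otimes> g \<otimes> z)" using g yc zc by (simp add: m_assoc)
      also have "\<dots> = H #> (g \<otimes> y \<otimes> z)"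
        using g yc zc by (intro rcos_mult_eq[OF comm[OF y g] refl]) simp_all
      finally show ?thesis
        using g yc zc by (simp add: commutator_mem_iff m_assoc)
    qed
    ultimately show "y \<otimes> z \<in> central_socle n"
      using yc zc by (simp add: central_socle_def)
  qed
  fix x y assume x: "x \<in> carrier G" and y: "y \<in> central_socle n"
  then have yc: "y \<in> carrier G" by (simp add: central_socle_def)
  have "(x \<otimes> y \<otimes> inv x) [^] n \<in> H"
    using x y yc by (simp add: pow_conj[symmetric] central_socle_def inv_op_closed2)
  moreover have "commutator G (x \<otimes> y \<otimes> inv x) g \<in> H" if g: "g \<in> carrier G" for g
  proof -
    have "x \<otimes> commutator G y (inv x \<otimes> g \<otimes> x) \<otimes> inv x \<in> H"
      using x y g by (intro inv_op_closed2) (auto simp: central_socle_def)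
    moreover have "x \<otimes> commutator G y (inv x \<otimes> g \<otimes> x) \<otimes> inv x = commutator G (x \<otimes> y \<otimes> inv x) g"
      using commutator_conj[of x y "inv x \<otimes> g \<otimes> x"] x yc g by (simp add: m_assoc inv_mult_cancel)
    ultimately show ?thesis by simp
  qed
  ultimately show "x \<otimes> y \<otimes> inv x \<in> central_socle n"
    using x yc by (simp add: central_socle_def)
qed

text \<open>
  A nontrivial central element of the \<open>p\<close>-group \<open>G / H\<close> has a power of order \<open>p\<close>.
\<close>

lemma central_socle_proper:
  assumes p: "Factorial_Ring.prime p" and card: "card (rcosets H) = p ^ k" and ne: "H \<noteq> carrier G"
  shows "\<exists>x\<in>central_socle p. x \<notin> H"
proof -
  interpret F: group "G Mod H" by (rule factorgroup_is_group)
  have ord: "order (G Mod H) = p ^ k"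
    using card by (simp add: order_def FactGroup_def)
  have "k \<noteq> 0"
  proof
    assume "k = 0"
    then have "card (rcosets H) = 1" using card by simp
    then obtain C where "rcosets H = {C}" by (rule card_1_singletonE)
    then have "H #> x = H" if "x \<in> carrier G" for x
      using that rcosetsI[OF subset, of x] rcosetsI[OF subset, of \<one>] coset_mult_one[OF subset] by auto
    then show False using ne rcos_eq_self_iff subset by auto
  qed
  then obtain c where c: "c \<in> carrier (G Mod H)" "c \<noteq> \<one>\<^bsub>G Mod H\<^esub>"
      "\<And>Y. Y \<in> carrier (G Mod H) \<Longrightarrow> Y \<otimes>\<^bsub>G Mod H\<^esub> c = c \<otimes>\<^bsub>G Mod H\<^esub> Y"
    using F.prime_power_order_center[OF p ord] by blast
  obtain x where x: "x \<in> carrier G" "c = H #> x"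
    using c(1) by (auto simp: carrier_FactGroup)
  have x_notin: "x \<notin> H" using c(2) x rcos_eq_self_iff by auto
  have x_central: "H #> (g \<otimes> x) = H #> (x \<otimes> g)" if "g \<in> carrier G" for g
    using c(3)[of "H #> g"] that x by (auto simp: carrier_FactGroup rcos_sum)
  have "c [^]\<^bsub>G Mod H\<^esub> (p ^ k) = \<one>\<^bsub>G Mod H\<^esub>"
    using F.pow_order_eq_1[OF c(1)] ord by simp
  then have "x [^] (p ^ k) \<in> H"
    using x by (simp add: FactGroup_pow rcos_eq_self_iff)
  define j where "j = (LEAST j. x [^] (p ^ j) \<in> H)"
  have j: "x [^] (p ^ j) \<in> H"
    unfolding j_def using \<open>x [^] (p ^ k) \<in> H\<close> by (rule LeastI)
  then obtain i where i: "j = Suc i"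
    using x x_notin by (cases j) auto
  have "x [^] (p ^ i) \<notin> H"
    using not_less_Least[of i "\<lambda>j. x [^] (p ^ j) \<in> H"] i by (simp add: j_def)
  moreover have "x [^] (p ^ i) \<in> central_socle p"
  proof -
    have "H #> (x [^] n \<otimes> g) = H #> (g \<otimes> x [^] n)" if g: "g \<in> carrier G" for g and n :: nat
    proof -
      have "commutator G g x \<in> H" using x_central g x by (simp add: commutator_mem_iff)
      show ?thesis
      proof (induction n)
        case (Suc n)
        have "H #> (x [^] n \<otimes> (x \<otimes> g)) = H #> (x [^] n \<otimes> (g \<otimes> x))"
          using x g by (intro rcos_mult_eq[OF refl x_central[OF g, symmetric]]) simp_all
        also have "\<dots> = H #> (x [^] n \<otimes> g \<otimes> x)" using x g by (simp add: m_assoc)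
        also have "\<dots> = H #> (g \<otimes> x [^] n \<otimes> x)"
          using x g by (intro rcos_mult_eq[OF Suc refl]) simp_all
        finally show ?case using x g by (simp add: m_assoc)
      qed (use g in simp)
    qed
    then show ?thesis
      using x j i by (simp add: central_socle_def commutator_mem_iff nat_pow_pow mult.commute)
  qed
  ultimately show ?thesis by blast
qed

end

text \<open>
  The finite \<open>p\<close>-group \<open>G / N\<close> is nilpotent, so its lower \<open>p\<close>-series ends at the trivial group.
  In the induction, \<open>M\<close> is enlarged to its central socle: if that contains \<open>Q l\<close>, then \<open>M\<close>
  contains the generators of \<open>Q (l + 1)\<close>. The number of cosets of \<open>N\<close> outside \<open>M\<close> decreases.
\<close>

lemma (in powerful_modulo) Q_eventually_subset:
  assumes index: "\<And>M. M \<lhd> G \<Longrightarrow> N \<subseteq> M \<Longrightarrow> \<exists>k. card (rcosets M) = p ^ k"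
    and M: "M \<lhd> G" "N \<subseteq> M"
  shows "\<exists>l. Q l \<subseteq> M"
  using M
proof (induction "card {C \<in> rcosets N. \<not> C \<subseteq> M}" arbitrary: M rule: less_induct)
  case less
  interpret M: normal M G by fact
  show ?case
  proof (cases "M = carrier G")
    case True
    then have "Q 0 \<subseteq> M" by simp
    then show ?thesis by blast
  next
    case False
    obtain k where "card (rcosets M) = p ^ k" using index less.prems by blast
    then obtain x where x: "x \<in> M.central_socle p" "x \<notin> M"
      using M.central_socle_proper prime False by blast
    have xc: "x \<in> carrier G" using x by (simp add: M.central_socle_def)
    interpret Z: normal "M.central_socle p" G by (rule M.central_socle_normal)
    obtain k where "card (rcosets N) = p ^ k" using index[OF normal_axioms] by blast
    then have "card (rcosets N) > 0" using prime_gt_0_nat[OF prime] by simp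
    then have fin: "finite (rcosets N)" by (rule card_ge_0_finite)
    have sub: "{C \<in> rcosets N. \<not> C \<subseteq> M.central_socle p} \<subseteq> {C \<in> rcosets N. \<not> C \<subseteq> M}"
      using M.subset_central_socle by blast
    have mem: "N #> x \<in> {C \<in> rcosets N. \<not> C \<subseteq> M}"
      using x xc rcosetsI[OF subset] rcos_self[OF xc is_subgroup] by auto
    have "N #> x \<subseteq> M.central_socle p"
      using x(1) less.prems(2) M.subset_central_socle by (auto simp: r_coset_def)
    then have "card {C \<in> rcosets N. \<not> C \<subseteq> M.central_socle p} < card {C \<in> rcosets N. \<not> C \<subseteq> M}"
      using sub mem fin by (intro psubset_card_mono) auto
    then obtain l where l: "Q l \<subseteq> M.central_socle p"
      using less.hyps Z.normal_axioms less.prems(2) M.subset_central_socle by blast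
    have "x [^] p \<in> M \<and> (\<forall>g\<in>carrier G. commutator G x g \<in> M)" if "x \<in> Q l" for x
      using subsetD[OF l that] unfolding M.central_socle_def by blast
    then have "Q (Suc l) \<subseteq> M"
      using less.prems(2) M.is_subgroup by (intro Q_Suc_subset_subgroup) blast+
    then show ?thesis by blast
  qed
qed

context powerful_modulo_generated begin

lemma Q_eq_ordered_prod_mult:
  assumes index: "\<And>M. M \<lhd> G \<Longrightarrow> N \<subseteq> M \<Longrightarrow> \<exists>k. card (rcosets M) = p ^ k"
    and x: "x \<in> Q n"
  shows "\<exists>e. \<exists>z\<in>N. x = ordered_prod G gs (\<lambda>g. g [^] (p ^ n * e g)) \<otimes> z"
proof -
  obtain l where l: "Q l \<subseteq> N"
    using Q_eventually_subset[OF index normal_axioms] by blast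
  let ?l = "max n l"
  interpret M: normal "Q ?l" G by (rule Q_normal)
  obtain e where e: "Q ?l #> x = Q ?l #> ordered_prod G gs (\<lambda>g. g [^] (p ^ n * e g))" (is "_ = _ #> ?P")
    using Q_ordered_prod[OF x, of ?l] by auto
  have carr: "x \<in> carrier G" "?P \<in> carrier G" using x Q_closed by auto
  have "inv ?P \<otimes> x \<in> Q ?l"
    using e M.rcos_eq_iff_left[OF carr] by blast
  then have "inv ?P \<otimes> x \<in> N"
    using l Q_antimono[of l ?l] by auto
  moreover have "x = ?P \<otimes> (inv ?P \<otimes> x)"
    using carr by (simp add: inv_mult_cancel)
  ultimately show ?thesis by blast
qed

end

section \<open>Open and closed subgroups of topological groups\<close>

lemma (in group) mem_l_coset_self: "x \<in> carrier G \<Longrightarrow> \<one> \<in> W \<Longrightarrow> x \<in> x <# W"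
  by (force simp: l_coset_def)

context topological_group begin

lemma continuous_map_mult:
  assumes "continuous_map A T f" "continuous_map A T h"
  shows "continuous_map A T (\<lambda>x. f x \<otimes> h x)"
  using continuous_map_compose[OF continuous_map_pairedI[OF assms] continuous_mult]
  by (simp add: o_def)

lemma continuous_map_carrier_const: "g \<in> carrier G \<Longrightarrow> continuous_map A T (\<lambda>_. g)"
  by (simp add: topspace_eq_carrier)

lemma openin_preimage_mult:
  assumes "openin T W" "g \<in> carrier G" "h \<in> carrier G"
  shows "openin T {x \<in> carrier G. g \<otimes> x \<otimes> h \<in> W}"
  using openin_continuous_map_preimage[OF continuous_map_mult[OF continuous_map_mult[OF
        continuous_map_carrier_const[OF assms(2)] continuous_map_id[unfolded id_def]] continuous_map_carrier_const[OF assms(3)]] assms(1)]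
  by (simp add: topspace_eq_carrier)

lemma openin_subset_carrier: "openin T W \<Longrightarrow> W \<subseteq> carrier G"
  using openin_subset topspace_eq_carrier by blast

lemma closedin_subset_carrier: "closedin T W \<Longrightarrow> W \<subseteq> carrier G"
  using closedin_subset topspace_eq_carrier by blast

lemma openin_l_coset:
  assumes "openin T W" "g \<in> carrier G"
  shows "openin T (g <# W)"
proof -
  have "g <# W = {x \<in> carrier G. inv g \<otimes> x \<otimes> \<one> \<in> W}"
  proof safe
    fix x assume "x \<in> g <# W"
    then show "x \<in> carrier G" "inv g \<otimes> x \<otimes> \<one> \<in> W"
      using openin_subset_carrier[OF assms(1)] assms(2) by (auto simp: l_coset_def inv_mult_cancel subset_iff)
  next
    fix x assume "x \<in> carrier G" "inv g \<otimes> x \<otimes> \<one> \<in> W"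
    then show "x \<in> g <# W"
      using assms(2) by (auto simp: l_coset_def intro!: bexI[of _ "inv g \<otimes> x"] simp: inv_mult_cancel)
  qed
  then show ?thesis using openin_preimage_mult[OF assms(1), of "inv g" \<one>] assms(2) by simp
qed

lemma closedin_r_coset:
  assumes "closedin T W" "g \<in> carrier G"
  shows "closedin T (W #> g)"
proof -
  have sub: "W \<subseteq> carrier G" using closedin_subset_carrier[OF assms(1)] .
  have "closedin T {x \<in> topspace T. x \<otimes> inv g \<in> W}"
    by (rule closedin_continuous_map_preimage[OF continuous_map_mult[OF continuous_map_id[unfolded id_def] continuous_map_carrier_const]])
      (use assms in auto)
  moreover have "W #> g = {x \<in> topspace T. x \<otimes> inv g \<in> W}"
    using sub assms(2)
    by (auto simp: r_coset_def topspace_eq_carrier m_assoc subset_iff intro!: bexI[of _ "_ \<otimes> inv g"])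
  ultimately show ?thesis by simp
qed

lemma openin_superset_subgroup:
  assumes "subgroup H G" "openin T W" "\<one> \<in> W" "W \<subseteq> H"
  shows "openin T H"
proof (subst openin_subopen, intro ballI exI conjI)
  fix h assume h: "h \<in> H"
  then have hc: "h \<in> carrier G" using assms(1) by (rule subgroup.mem_carrier[rotated])
  show "openin T (h <# W)" using assms(2) hc by (rule openin_l_coset)
  show "h \<in> h <# W" using assms(3) hc mem_l_coset_self by blast
  show "h <# W \<subseteq> H" using assms h by (auto simp: l_coset_def intro: subgroup.m_closed)
qed

text \<open>
  The complement of a subgroup is a union of cosets.
\<close>

lemma open_subgroup_closed:
  assumes "subgroup H G" "openin T H"
  shows "closedin T H"
proof -
  have "openin T (carrier G - H)"
  proof (subst openin_subopen, intro ballI exI conjI)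
    fix g assume g: "g \<in> carrier G - H"
    show "openin T (g <# H)" using assms g by (intro openin_l_coset) auto
    show "g \<in> g <# H"
      using g subgroup.one_closed[OF assms(1)] mem_l_coset_self by blast
    show "g <# H \<subseteq> carrier G - H"
    proof
      fix x assume "x \<in> g <# H"
      then obtain h where h: "h \<in> H" "x = g \<otimes> h" by (auto simp: l_coset_def)
      have hc: "h \<in> carrier G" using h subgroup.mem_carrier[OF assms(1)] by blast
      have "x \<notin> H"
      proof
        assume "x \<in> H"
        then have "x \<otimes> inv h \<in> H" using h assms(1) by (simp add: subgroup.m_closed subgroup.m_inv_closed)
        then show False using g h hc by (simp add: m_assoc)
      qed
      then show "x \<in> carrier G - H" using g h hc by simp
    qed
  qed
  then show ?thesis
    using openin_subset_carrier[OF assms(2)] by (simp add: closedin_def topspace_eq_carrier)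
qed

text \<open>
  The complement is a finite union of closed cosets.
\<close>

lemma closed_subgroup_finite_index_open:
  assumes "subgroup H G" "closedin T H" "finite R" "R \<subseteq> carrier G"
    and cover: "carrier G \<subseteq> (\<Union>r\<in>R. H #> r)"
  shows "openin T H"
proof -
  have "carrier G - H = (\<Union>r\<in>R - H. H #> r)"
  proof
    show "carrier G - H \<subseteq> (\<Union>r\<in>R - H. H #> r)"
    proof
      fix x assume x: "x \<in> carrier G - H"
      then obtain r where r: "r \<in> R" "x \<in> H #> r" using cover by blast
      have "r \<notin> H"
      proof
        assume "r \<in> H"
        then have "H #> r = H"
          using assms(1) subgroup.mem_carrier[OF assms(1)] by (simp add: coset_join2)
        then show False using r x by blast
      qed
      then show "x \<in> (\<Union>r\<in>R - H. H #> r)" using r by blast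
    qed
    show "(\<Union>r\<in>R - H. H #> r) \<subseteq> carrier G - H"
    proof clarify
      fix x r assume r: "r \<in> R" "r \<notin> H" "x \<in> H #> r"
      then obtain h where h: "h \<in> H" "x = h \<otimes> r" by (auto simp: r_coset_def)
      have c: "h \<in> carrier G" "r \<in> carrier G" using h r assms subgroup.mem_carrier by auto
      have "x \<notin> H"
      proof
        assume "x \<in> H"
        then have "inv h \<otimes> x \<in> H" using h assms(1) by (simp add: subgroup.m_closed subgroup.m_inv_closed)
        then show False using h c r by (simp add: inv_mult_cancel)
      qed
      then show "x \<in> carrier G - H" using h c by simp
    qed
  qed
  moreover have "closedin T (\<Union>r\<in>R - H. H #> r)"
    using assms by (intro closedin_Union) (auto intro: closedin_r_coset)
  ultimately have "closedin T (carrier G - H)" by simp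
  then have "openin T (topspace T - (carrier G - H))" by blast
  moreover have "topspace T - (carrier G - H) = H"
    using closedin_subset_carrier[OF assms(2)] by (auto simp: topspace_eq_carrier)
  ultimately show ?thesis by simp
qed

lemma in_closure_of_group:
  assumes "x \<in> T closure_of S" "openin T W" "\<one> \<in> W"
  obtains w where "w \<in> W" "x \<otimes> w \<in> S"
proof -
  have x: "x \<in> carrier G" using assms(1) subsetD[OF closure_of_subset_topspace] by (simp add: topspace_eq_carrier[symmetric])
  have "x \<in> x <# W" using x assms(3) by (rule mem_l_coset_self)
  then obtain y where "y \<in> S" "y \<in> x <# W"
    using assms(1) openin_l_coset[OF assms(2) x] by (auto simp: in_closure_of)
  then show ?thesis using that by (auto simp: l_coset_def)
qed

end

text \<open>
  By compactness an open subgroup \<open>H\<close> has finitely many left cosets \<open>g H\<close>. Since \<open>g H g\<^sup>-\<^sup>1\<close>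
  depends only on the coset, the intersection of all conjugates of \<open>H\<close> is open.
\<close>

lemma (in profinite_group) open_normal_base:
  assumes "openin T W" "\<one> \<in> W"
  shows "\<exists>N. N \<lhd> G \<and> openin T N \<and> N \<subseteq> W"
proof -
  obtain H where H: "subgroup H G" "openin T H" "H \<subseteq> W"
    using open_subgroups_base assms by blast
  have Hc: "H \<subseteq> carrier G" using H(1) by (rule subgroup.subset)
  define conjugate where "conjugate = (\<lambda>g. {x \<in> carrier G. inv g \<otimes> x \<otimes> g \<in> H})"
  have conjugate_open: "openin T (conjugate g)" if "g \<in> carrier G" for g
    unfolding conjugate_def using H(2) that by (intro openin_preimage_mult) auto
  have cosets: "\<exists>F. finite F \<and> F \<subseteq> carrier G \<and> topspace T \<subseteq> (\<Union>g\<in>F. g <# H)"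
  proof -
    have "topspace T \<subseteq> (\<Union>g\<in>carrier G. g <# H)"
      using subgroup.one_closed[OF H(1)]
      mem_l_coset_self by (force simp: topspace_eq_carrier)
    moreover have "\<And>U. U \<in> (\<lambda>g. g <# H) ` carrier G \<Longrightarrow> openin T U"
      using openin_l_coset[OF H(2)] by blast
    ultimately obtain F where "finite F" "F \<subseteq> (\<lambda>g. g <# H) ` carrier G" "topspace T \<subseteq> \<Union> F"
      using compact unfolding compact_space_alt by metis
    then show ?thesis by (metis finite_subset_image)
  qed
  then obtain F where F: "finite F" "F \<subseteq> carrier G" "topspace T \<subseteq> (\<Union>g\<in>F. g <# H)" by blast
  have "F \<noteq> {}" using F(3) topspace_eq_carrier one_closed by auto
  define N where "N = (\<Inter>g\<in>carrier G. conjugate g)"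
  have conjugate_mult: "conjugate (g \<otimes> h) = conjugate g" if "g \<in> carrier G" "h \<in> H" for g h
  proof -
    have h: "h \<in> carrier G" using that Hc by blast
    have eq: "inv (g \<otimes> h) \<otimes> x \<otimes> (g \<otimes> h) = inv h \<otimes> (inv g \<otimes> x \<otimes> g) \<otimes> h" if "x \<in> carrier G" for x
      using that h \<open>g \<in> carrier G\<close> by (simp add: inv_mult_group m_assoc)
    have "inv h \<otimes> y \<otimes> h \<in> H \<longleftrightarrow> y \<in> H" if y: "y \<in> carrier G" for y
    proof
      assume "inv h \<otimes> y \<otimes> h \<in> H"
      then have "h \<otimes> (inv h \<otimes> y \<otimes> h) \<otimes> inv h \<in> H"
        using \<open>h \<in> H\<close> H(1) by (simp only: subgroup.m_closed subgroup.m_inv_closed)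
      then show "y \<in> H" using y h by (simp add: m_assoc inv_mult_cancel)
    next
      assume "y \<in> H"
      then show "inv h \<otimes> y \<otimes> h \<in> H"
        using \<open>h \<in> H\<close> H(1) by (simp only: subgroup.m_closed subgroup.m_inv_closed)
    qed
    then show ?thesis
      using that h by (auto simp: conjugate_def eq)
  qed
  have N_eq: "N = (\<Inter>g\<in>F. conjugate g)"
  proof
    show "N \<subseteq> (\<Inter>g\<in>F. conjugate g)" using F(2) by (auto simp: N_def)
    show "(\<Inter>g\<in>F. conjugate g) \<subseteq> N"
      unfolding N_def
    proof (rule INF_greatest)
      fix g assume "g \<in> carrier G"
      then obtain f h where fh: "f \<in> F" "h \<in> H" "g = f \<otimes> h"
        using F(3) topspace_eq_carrier by (fastforce simp: l_coset_def)
      then have "conjugate g = conjugate f" using conjugate_mult F(2) by blast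
      then show "(\<Inter>g\<in>F. conjugate g) \<subseteq> conjugate g" using fh by blast
    qed
  qed
  have "openin T N"
    unfolding N_eq using F \<open>F \<noteq> {}\<close> conjugate_open by (intro openin_INT2) auto
  moreover have "N \<lhd> G"
  proof (rule normal_invI)
    show "subgroup N G"
    proof (rule subgroupI)
      show "N \<subseteq> carrier G" by (auto simp: N_def conjugate_def)
      have "\<one> \<in> N" using subgroup.one_closed[OF H(1)] by (auto simp: N_def conjugate_def)
      then show "N \<noteq> {}" by blast
      fix x assume x: "x \<in> N"
      have xc: "x \<in> carrier G" using x by (auto simp: N_def conjugate_def)
      show "inv x \<in> N"
        unfolding N_def
      proof (rule INT_I)
        fix g assume g: "g \<in> carrier G"
        then have "inv g \<otimes> x \<otimes> g \<in> H" using x by (auto simp: N_def conjugate_def)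
        then have "inv (inv g \<otimes> x \<otimes> g) \<in> H" using H(1) by (rule subgroup.m_inv_closed[rotated])
        then show "inv x \<in> conjugate g"
          using g xc by (simp add: conjugate_def inv_mult_group m_assoc)
      qed
      fix y assume y: "y \<in> N"
      have yc: "y \<in> carrier G" using y by (auto simp: N_def conjugate_def)
      show "x \<otimes> y \<in> N"
        unfolding N_def
      proof (rule INT_I)
        fix g assume g: "g \<in> carrier G"
        then have "inv g \<otimes> x \<otimes> g \<in> H" "inv g \<otimes> y \<otimes> g \<in> H" using x y by (auto simp: N_def conjugate_def)
        then have "inv g \<otimes> x \<otimes> g \<otimes> (inv g \<otimes> y \<otimes> g) \<in> H"
          using H(1) by (simp only: subgroup.m_closed)
        then show "x \<otimes> y \<in> conjugate g"
          using g xc yc by (simp add: conjugate_def m_assoc inv_mult_cancel)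
      qed
    qed
    fix a x assume a: "a \<in> carrier G" and x: "x \<in> N"
    have xc: "x \<in> carrier G" using x by (auto simp: N_def conjugate_def)
    show "a \<otimes> x \<otimes> inv a \<in> N"
      unfolding N_def
    proof (rule INT_I)
      fix g assume g: "g \<in> carrier G"
      then have "x \<in> conjugate (inv a \<otimes> g)" using a x by (simp add: N_def)
      then show "a \<otimes> x \<otimes> inv a \<in> conjugate g"
        using a g xc by (simp add: conjugate_def inv_mult_group m_assoc)
    qed
  qed
  moreover have "N \<subseteq> H"
  proof
    fix x assume x: "x \<in> N"
    then have "x \<in> conjugate \<one>" by (simp add: N_def)
    then show "x \<in> H" by (auto simp: conjugate_def)
  qed
  ultimately show ?thesis using H(3) by blast
qed

section \<open>Procyclic subgroups\<close>

definition (in topological_group) procyclic :: "'a \<Rightarrow> 'a set" where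
  "procyclic x = T closure_of (generate G {x})"

lemma (in topological_group) procyclic_subset:
  assumes "x \<in> S" "subgroup S G" "closedin T S"
  shows "procyclic x \<subseteq> S"
  unfolding procyclic_def using assms by (intro closure_of_minimal generate_subgroup_incl) auto

lemma (in topological_group) procyclic_nat_pow_subset:
  assumes "x \<in> carrier G"
  shows "procyclic (x [^] (n :: nat)) \<subseteq> procyclic x"
  unfolding procyclic_def using assms
  by (intro closure_of_mono generate_subgroup_incl generate_is_subgroup)
    (auto simp: nat_pow_mem_generate)

lemma (in topological_group) nat_pow_mem_procyclic:
  assumes "x \<in> carrier G"
  shows "x [^] (n :: nat) \<in> procyclic x"
proof -
  have "generate G {x} \<subseteq> procyclic x"
    unfolding procyclic_def using assms
    by (intro closure_of_subset) (simp add: topspace_eq_carrier generate_incl)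
  then show ?thesis using assms nat_pow_mem_generate by blast
qed

lemma (in topological_group) procyclic_commutes:
  assumes "Hausdorff_space T" "g \<in> carrier G" "y \<in> procyclic g"
  shows "g \<otimes> y = y \<otimes> g"
proof -
  let ?Z = "{y \<in> carrier G. g \<otimes> y = y \<otimes> g}"
  note const = continuous_map_carrier_const[OF assms(2), of T]
    and ident = continuous_map_id[of T, unfolded id_def]
  have "closedin T {y \<in> topspace T. g \<otimes> y = y \<otimes> g}"
    by (rule closedin_continuous_maps_eq[OF assms(1) continuous_map_mult[OF const ident]
          continuous_map_mult[OF ident const]])
  then have "closedin T ?Z" by (simp add: topspace_eq_carrier)
  moreover have "subgroup ?Z G"
  proof (rule subgroupI)
    show "?Z \<noteq> {}" using assms(2) by (auto intro!: exI[of _ \<one>])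
    fix a assume a: "a \<in> ?Z"
    then have ac: "a \<in> carrier G" by simp
    from a have "inv a \<otimes> (g \<otimes> a) \<otimes> inv a = inv a \<otimes> (a \<otimes> g) \<otimes> inv a" by simp
    then have "g \<otimes> inv a = inv a \<otimes> g"
      using ac assms(2) by (simp add: m_assoc inv_mult_cancel)
    then show "inv a \<in> ?Z" using ac by simp
    fix b assume b: "b \<in> ?Z"
    then have bc: "b \<in> carrier G" by simp
    have "g \<otimes> (a \<otimes> b) = (g \<otimes> a) \<otimes> b" using ac bc assms(2) by (simp add: m_assoc)
    also have "g \<otimes> a = a \<otimes> g" using a by simp
    also have "a \<otimes> g \<otimes> b = a \<otimes> (g \<otimes> b)" using ac bc assms(2) by (simp add: m_assoc)
    also have "g \<otimes> b = b \<otimes> g" using b by simp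
    also have "a \<otimes> (b \<otimes> g) = a \<otimes> b \<otimes> g" using ac bc assms(2) by (simp add: m_assoc)
    finally show "a \<otimes> b \<in> ?Z" using ac bc by simp
  qed auto
  ultimately have "procyclic g \<subseteq> ?Z"
    using assms(2) by (intro procyclic_subset) auto
  then show ?thesis using assms(3) by blast
qed

lemma (in topological_group) continuous_map_nat_pow:
  "continuous_map T T (\<lambda>x. x [^] (n :: nat))"
proof (induction n)
  case (Suc n)
  then show ?case
    using continuous_map_mult[OF Suc continuous_map_id[unfolded id_def]] by simp
qed (simp add: topspace_eq_carrier)

section \<open>Neighbourhoods of the identity in powerful pro-\<open>p\<close> groups\<close>

lemma lower_p_series_mono:
  assumes "group G" "N \<subseteq> N'"
  shows "lower_p_series G p N i \<subseteq> lower_p_series G p N' i"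
proof (induction i)
  case (Suc i)
  interpret group G by fact
  show ?case
    unfolding lower_p_series.simps
    by (rule mono_generate) (use Suc assms in blast)
qed simp

lemma (in group) mem_set_mult_foldr:
  "(\<And>i. i \<in> set is \<Longrightarrow> a i \<in> A i) \<Longrightarrow> ordered_prod G is a \<in> foldr (\<lambda>i S. A i <#> S) is {\<one>}"
  by (induction "is") (auto simp: set_mult_def)

lemma (in group) foldr_set_mult_subset_subgroup:
  "subgroup K G \<Longrightarrow> (\<And>i. i \<in> set is \<Longrightarrow> A i \<subseteq> K) \<Longrightarrow> foldr (\<lambda>i S. A i <#> S) is {\<one>} \<subseteq> K"
  by (induction "is") (auto simp: set_mult_def subgroup.one_closed subset_iff intro!: subgroup.m_closed)

lemma (in topological_group) compactin_set_mult:
  assumes "compactin T A" "compactin T B"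
  shows "compactin T (A <#> B)"
proof -
  have "compactin (prod_topology T T) (A \<times> B)"
    using assms by (simp add: compactin_Times)
  then have "compactin T ((\<lambda>(x, y). x \<otimes> y) ` (A \<times> B))"
    using continuous_mult by (rule image_compactin)
  moreover have "(\<lambda>(x, y). x \<otimes> y) ` (A \<times> B) = A <#> B"
    by (force simp: set_mult_def)
  ultimately show ?thesis by simp
qed

lemma (in topological_group) compactin_foldr_set_mult:
  "(\<And>i. i \<in> set is \<Longrightarrow> compactin T (A i)) \<Longrightarrow> compactin T (foldr (\<lambda>i S. A i <#> S) is {\<one>})"
  by (induction "is") (auto simp: compactin_set_mult topspace_eq_carrier)

context pro_p_group begin

lemma open_normal_above:
  assumes "N \<lhd> G" "openin T N" "M \<lhd> G" "N \<subseteq> M"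
  shows "openin T M"
  using assms normal_imp_subgroup[OF assms(1)] normal_imp_subgroup[OF assms(3)]
  by (intro openin_superset_subgroup[of M N]) (auto simp: subgroup.one_closed)

text \<open>
  The subgroup generated by the powers and \<open>N\<close> is open, hence closed, so it absorbs the topological
  closure in the definition of a powerful group.
\<close>

lemma powerful_modulo_open_normal:
  assumes p: "Factorial_Ring.prime p" and pow: "powerful p G T"
    and N: "N \<lhd> G" "openin T N"
  shows "powerful_modulo N G p"
proof -
  interpret N: normal N G by fact
  define q where "q = (if p = 2 then 4 else p)"
  define P where "P = power_subgroup G q"
  let ?C = "T closure_of P"
  let ?L = "generate G ((\<lambda>y. y [^] q) ` carrier G \<union> N)"
  have comm: "comm_group (G Mod ?C)"
    using pow by (auto simp: powerful_def P_def q_def)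
  have conj_pow: "g \<otimes> y [^] q \<otimes> inv g \<in> (\<lambda>y. y [^] q) ` carrier G"
    if "g \<in> carrier G" "y \<in> carrier G" for g y
    using that by (auto simp: pow_conj intro!: imageI)
  interpret L: normal ?L G
  proof (rule normal_generateI)
    show "(\<lambda>y. y [^] q) ` carrier G \<union> N \<subseteq> carrier G"
      using N.subset by auto
    show "g \<otimes> h \<otimes> inv g \<in> (\<lambda>y. y [^] q) ` carrier G \<union> N"
      if "h \<in> (\<lambda>y. y [^] q) ` carrier G \<union> N" "g \<in> carrier G" for h g
      using that conj_pow N.inv_op_closed2 by blast
  qed
  have NL: "N \<subseteq> ?L" by (auto intro: generate.incl)
  have "openin T ?L"
    by (rule open_normal_above[OF N L.normal_axioms NL])
  then have L_closed: "closedin T ?L"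
    using L.is_subgroup by (intro open_subgroup_closed)
  have "P \<subseteq> ?L"
    unfolding P_def power_subgroup_def by (rule mono_generate) auto
  then have CL: "?C \<subseteq> ?L" using L_closed by (intro closure_of_minimal)
  have "P \<subseteq> topspace T"
    unfolding P_def power_subgroup_def topspace_eq_carrier by (rule generate_incl) auto
  then have one_C: "\<one> \<in> ?C"
    using closure_of_subset[of P T] generate.one[of G "(\<lambda>x. x [^] q) ` carrier G"]
    unfolding P_def power_subgroup_def by blast
  have C_carr: "?C \<subseteq> carrier G" using CL L.subset by blast
  have "commutator G x g \<in> ?L" if xg: "x \<in> carrier G" "g \<in> carrier G" for x g
  proof -
    have "(?C #> x) <#> (?C #> g) = (?C #> g) <#> (?C #> x)"
      using comm_groupE(4)[OF comm, of "?C #> x" "?C #> g"] xg by (auto simp: carrier_FactGroup)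
    moreover have "x \<otimes> g \<in> (?C #> x) <#> (?C #> g)"
      using one_C xg by (force simp: set_mult_def r_coset_def)
    ultimately obtain h h' where h: "h \<in> ?C" "h' \<in> ?C" "x \<otimes> g = h \<otimes> g \<otimes> (h' \<otimes> x)"
      by (auto simp: set_mult_def r_coset_def)
    have hc: "h \<in> carrier G" "h' \<in> carrier G" using h C_carr by auto
    have "?L #> (x \<otimes> g) = ?L #> (h \<otimes> g \<otimes> (h' \<otimes> x))"
      using h(3) by simp
    also have "\<dots> = (?L #> (h \<otimes> g)) <#> (?L #> (h' \<otimes> x))"
      using hc xg by (simp add: L.rcos_sum)
    also have "?L #> (h \<otimes> g) = ?L #> g"
      using hc h CL xg by (subst L.rcos_eq_iff) (auto simp: m_assoc)
    also have "?L #> (h' \<otimes> x) = ?L #> x"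
      using hc h CL xg by (subst L.rcos_eq_iff) (auto simp: m_assoc)
    also have "(?L #> g) <#> (?L #> x) = ?L #> (g \<otimes> x)"
      using xg by (simp add: L.rcos_sum)
    finally show ?thesis
      using xg by (simp add: L.commutator_mem_iff)
  qed
  then show ?thesis
    by unfold_locales (simp_all add: p q_def)
qed

lemma generated_modulo_open_normal:
  assumes "T closure_of (generate G S) = carrier G" "S \<subseteq> carrier G" and N: "N \<lhd> G" "openin T N"
  shows "carrier G \<subseteq> generate G (S \<union> N)"
proof
  fix x assume x: "x \<in> carrier G"
  interpret N: normal N G by fact
  obtain w where w: "w \<in> N" "x \<otimes> w \<in> generate G S"
    using in_closure_of_group[of x "generate G S" N] assms x N.one_closed
    by (metis N.is_subgroup subgroup.one_closed)
  have "x \<otimes> w \<in> generate G (S \<union> N)"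
    using w(2) mono_generate[of S "S \<union> N"] by blast
  moreover have "inv w \<in> generate G (S \<union> N)"
    using N.m_inv_closed[OF w(1)] by (auto intro: generate.incl)
  ultimately have "x \<otimes> w \<otimes> inv w \<in> generate G (S \<union> N)" by (rule generate.eng)
  then show "x \<in> generate G (S \<union> N)" using x w by (simp add: m_assoc)
qed

lemma powerful_modulo_generated_open_normal:
  assumes "Factorial_Ring.prime p" "powerful p G T"
    and "distinct gs" "set gs \<subseteq> carrier G" "T closure_of (generate G (set gs)) = carrier G"
    and "N \<lhd> G" "openin T N"
  shows "powerful_modulo_generated N G p gs"
  using assms powerful_modulo_open_normal[of N] generated_modulo_open_normal[of "set gs" N]
  by (simp add: powerful_modulo_generated_def powerful_modulo_generated_axioms_def)

text \<open>
  The neighbourhood is the intersection \<open>H\<close> of the subgroups \<open>Q n\<close> belonging to all open normal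
  subgroups \<open>N\<close>. It is open because it is closed of finite index: reducing exponents modulo \<open>p\<^sup>n\<close>
  yields one finite set of coset representatives that serves every \<open>N\<close>. It lies in the product
  because its elements do so modulo every \<open>N\<close> and the product is compact, hence closed.
\<close>

lemma powerful_product_neighbourhood:
  assumes p: "Factorial_Ring.prime p" and pow: "powerful p G T"
    and gs: "distinct gs" "set gs \<subseteq> carrier G" "T closure_of (generate G (set gs)) = carrier G"
  shows "\<exists>H. openin T H \<and> \<one> \<in> H \<and>
    H \<subseteq> foldr (\<lambda>g S. procyclic (g [^] (p ^ n)) <#> S) gs {\<one>}"
proof -
  let ?Q = "\<lambda>N. lower_p_series G p N n"
  define \<N> where "\<N> = {N. N \<lhd> G \<and> openin T N}"
  have gen: "powerful_modulo_generated N G p gs" if "N \<in> \<N>" for N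
    using that powerful_modulo_generated_open_normal assms by (simp add: \<N>_def)
  have Q_normal: "?Q N \<lhd> G" and N_sub: "N \<subseteq> ?Q N" if "N \<in> \<N>" for N
  proof -
    interpret powerful_modulo_generated N G p gs by (rule gen[OF that])
    show "?Q N \<lhd> G" "N \<subseteq> ?Q N" by (rule Q_normal, rule N_subset_Q)
  qed
  have decomp: "\<exists>e. \<exists>z\<in>N. x = ordered_prod G gs (\<lambda>g. g [^] (p ^ i * e g)) \<otimes> z"
    if N: "N \<in> \<N>" and x: "x \<in> lower_p_series G p N i" for N x i
  proof -
    interpret powerful_modulo_generated N G p gs by (rule gen[OF N])
    have "\<exists>k. card (rcosets M) = p ^ k" if "M \<lhd> G" "N \<subseteq> M" for M
      using that N open_normal_above[of N M] index_open_normal by (simp add: \<N>_def)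
    then show ?thesis using Q_eq_ordered_prod_mult x by blast
  qed
  have carrier_\<N>: "carrier G \<in> \<N>"
    using openin_topspace[of T] by (simp add: \<N>_def normal_self topspace_eq_carrier)
  have gs_mem: "g \<in> carrier G" if "g \<in> set gs" for g
    using that gs by blast
  define H where "H = (\<Inter>N\<in>\<N>. ?Q N)"
  have H_sub: "subgroup H G"
    unfolding H_def using carrier_\<N> Q_normal normal_imp_subgroup
    by (intro subgroups_Inter) auto
  have H_closed: "closedin T H"
    unfolding H_def
  proof (rule closedin_INT)
    show "\<N> \<noteq> {}" using carrier_\<N> by blast
    fix N assume N: "N \<in> \<N>"
    then have "openin T (?Q N)"
      using open_normal_above Q_normal N_sub unfolding \<N>_def by blast
    then show "closedin T (?Q N)"
      using Q_normal[OF N] by (intro open_subgroup_closed normal_imp_subgroup)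
  qed
  \<comment> \<open>Exponents only matter modulo \<open>p\<^sup>n\<close>, so finitely many ordered products represent all cosets
    of \<open>Q n\<close>, whatever \<open>N\<close> is.\<close>
  define R where
    "R = (\<lambda>e. ordered_prod G gs (\<lambda>g. g [^] (e g :: nat))) ` (set gs \<rightarrow>\<^sub>E {..<p ^ n})"
  have R: "finite R" "R \<subseteq> carrier G"
    unfolding R_def using gs_mem by (auto intro!: finite_imageI finite_PiE ordered_prod_closed)
  have cover_N: "\<exists>r\<in>R. x \<otimes> inv r \<in> ?Q N" if N: "N \<in> \<N>" and x: "x \<in> carrier G" for N x
  proof -
    interpret Q: normal "?Q N" G by (rule Q_normal[OF N])
    interpret powerful_modulo_generated N G p gs by (rule gen[OF N])
    obtain e z where e: "z \<in> N" "x = ordered_prod G gs (\<lambda>g. g [^] (e g :: nat)) \<otimes> z"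
      using decomp[OF N, of x 0] x by auto
    define f where "f = (\<lambda>g\<in>set gs. e g mod p ^ n)"
    let ?r = "ordered_prod G gs (\<lambda>g. g [^] f g)"
    have "?Q N #> x = ?Q N #> ordered_prod G gs (\<lambda>g. g [^] e g)"
      using e gs_mem N_sub[OF N] by (auto simp: Q.rcos_mult_mem)
    also have "\<dots> = ?Q N #> ?r"
    proof (rule Q.rcos_ordered_prod_cong)
      fix g assume g: "g \<in> set gs"
      have "g [^] e g = g [^] f g \<otimes> g [^] (p ^ n * (e g div p ^ n))"
        using g gs_mem by (simp add: f_def nat_pow_mult)
      then show "?Q N #> g [^] e g = ?Q N #> g [^] f g"
        using g gs_mem pow_mult_mem_Q by (simp add: Q.rcos_mult_mem)
    qed (use gs_mem in auto)
    finally have "x \<otimes> inv ?r \<in> ?Q N"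
      using x gs_mem by (simp add: Q.rcos_eq_iff)
    moreover have "?r \<in> R"
      unfolding R_def f_def using prime_gt_0_nat[OF p] by (intro imageI) auto
    ultimately show ?thesis by blast
  qed
  have H_cover: "carrier G \<subseteq> (\<Union>r\<in>R. H #> r)"
  proof
    fix x assume x: "x \<in> carrier G"
    have "\<exists>r\<in>R. x \<otimes> inv r \<in> H"
    proof (rule ccontr)
      assume "\<not> ?thesis"
      then have "\<forall>r\<in>R. \<exists>N\<in>\<N>. x \<otimes> inv r \<notin> ?Q N" by (auto simp: H_def)
      then obtain N where N: "\<And>r. r \<in> R \<Longrightarrow> N r \<in> \<N> \<and> x \<otimes> inv r \<notin> ?Q (N r)" by metis
      \<comment> \<open>If every representative failed for some \<open>N\<close>, then all would fail for the intersection of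
        these finitely many \<open>N\<close>.\<close>
      define M where "M = (\<Inter>r\<in>R. N r)"
      have "R \<noteq> {}" using cover_N[OF carrier_\<N> x] by blast
      then have "openin T M"
        unfolding M_def using R(1) N by (intro openin_INT2) (auto simp: \<N>_def)
      moreover have "M \<lhd> G"
        unfolding M_def
      proof (rule normal_invI)
        show "subgroup (\<Inter>r\<in>R. N r) G"
          using \<open>R \<noteq> {}\<close> N by (intro subgroups_Inter) (auto simp: \<N>_def normal_imp_subgroup)
        show "a \<otimes> h \<otimes> inv a \<in> (\<Inter>r\<in>R. N r)" if "a \<in> carrier G" "h \<in> (\<Inter>r\<in>R. N r)" for a h
          using that N by (auto simp: \<N>_def intro: normal.inv_op_closed2)
      qed
      ultimately have "M \<in> \<N>" by (simp add: \<N>_def)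
      then obtain r where r: "r \<in> R" "x \<otimes> inv r \<in> ?Q M" using cover_N x by blast
      have "?Q M \<subseteq> ?Q (N r)"
        using r N by (intro lower_p_series_mono) (auto simp: M_def \<N>_def is_group)
      then show False using N r by blast
    qed
    then obtain r where r: "r \<in> R" "x \<otimes> inv r \<in> H" by blast
    then have "x = x \<otimes> inv r \<otimes> r" using x R by (auto simp: m_assoc)
    then show "x \<in> (\<Union>r\<in>R. H #> r)" using r by (auto simp: r_coset_def)
  qed
  have "openin T H"
    by (rule closed_subgroup_finite_index_open[OF H_sub H_closed R H_cover])
  moreover have "\<one> \<in> H" using H_sub by (rule subgroup.one_closed)
  moreover have "H \<subseteq> foldr (\<lambda>g S. procyclic (g [^] (p ^ n)) <#> S) gs {\<one>}" (is "_ \<subseteq> ?B")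
  proof
    fix x assume x: "x \<in> H"
    have "compactin T ?B"
      unfolding procyclic_def
      by (intro compactin_foldr_set_mult closedin_compact_space compact closedin_closure_of)
    then have "closedin T ?B"
      using Hausdorff by (rule compactin_imp_closedin[rotated])
    have xc: "x \<in> carrier G" using x H_sub by (rule subgroup.mem_carrier[rotated])
    have "x \<in> T closure_of ?B"
      unfolding in_closure_of
    proof (intro conjI allI impI)
      show "x \<in> topspace T" using xc by (simp add: topspace_eq_carrier)
      fix W assume W: "x \<in> W \<and> openin T W"
      have "openin T (inv x <# W)" using W xc by (intro openin_l_coset) auto
      moreover have "\<one> \<in> inv x <# W" using W xc by (force simp: l_coset_def)
      ultimately obtain N where N: "N \<in> \<N>" "N \<subseteq> inv x <# W"
        using open_normal_base unfolding \<N>_def by blast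
      interpret N: normal N G using N by (simp add: \<N>_def)
      have "x \<in> ?Q N" using x N by (auto simp: H_def)
      then obtain e z where e: "z \<in> N" "x = ordered_prod G gs (\<lambda>g. g [^] (p ^ n * e g)) \<otimes> z"
        using decomp[OF N(1)] by blast
      let ?P = "ordered_prod G gs (\<lambda>g. g [^] (p ^ n * e g))"
      have z: "z \<in> carrier G" using e N.subset by blast
      have P: "?P \<in> carrier G" using gs_mem by auto
      have "inv z \<in> inv x <# W" using N N.m_inv_closed[OF e(1)] by blast
      then obtain w where w: "w \<in> W" "inv z = inv x \<otimes> w" by (auto simp: l_coset_def)
      have wc: "w \<in> carrier G" using w W openin_subset_carrier by blast
      have "x \<otimes> inv z = w" using w xc wc by (simp add: inv_mult_cancel)
      moreover have "x \<otimes> inv z = ?P" using e(2) z P by (simp add: m_assoc)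
      ultimately have "?P \<in> W" using w by simp
      moreover have "?P \<in> ?B"
      proof (rule mem_set_mult_foldr)
        fix g assume g: "g \<in> set gs"
        have "g [^] (p ^ n * e g) = (g [^] (p ^ n)) [^] e g" using g gs_mem by (simp add: nat_pow_pow)
        also have "\<dots> \<in> generate G {g [^] (p ^ n)}"
          using g gs_mem by (intro nat_pow_mem_generate) auto
        also have "\<dots> \<subseteq> procyclic (g [^] (p ^ n))"
          unfolding procyclic_def using g gs_mem
          by (intro closure_of_subset) (simp add: topspace_eq_carrier generate_incl)
        finally show "g [^] (p ^ n * e g) \<in> procyclic (g [^] (p ^ n))" .
      qed
      ultimately show "\<exists>y. y \<in> ?B \<and> y \<in> W" by blast
    qed
    then show "x \<in> ?B" using \<open>closedin T ?B\<close> by (simp add: closure_of_closedin)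
  qed
  ultimately show ?thesis by blast
qed

lemma subgroup_containing_procyclic_open:
  assumes p: "Factorial_Ring.prime p" and pow: "powerful p G T"
    and fg: "topologically_finitely_generated G T"
    and K: "subgroup K G" "\<And>g. g \<in> carrier G \<Longrightarrow> \<exists>n. procyclic (g [^] (p ^ n)) \<subseteq> K"
  shows "openin T K"
proof -
  obtain gs where gs: "distinct gs" "set gs \<subseteq> carrier G" "T closure_of (generate G (set gs)) = carrier G"
    using fg finite_distinct_list unfolding topologically_finitely_generated_def by metis
  obtain n where n: "\<And>g. g \<in> carrier G \<Longrightarrow> procyclic (g [^] (p ^ n g)) \<subseteq> K"
    using K(2) by metis
  \<comment> \<open>The sum is a convenient common upper bound of the exponents.\<close>
  define m where "m = (\<Sum>g\<leftarrow>gs. n g)"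
  have "procyclic (g [^] (p ^ m)) \<subseteq> K" if g: "g \<in> set gs" for g
  proof -
    have gc: "g \<in> carrier G" using g gs by blast
    have "n g \<le> m" unfolding m_def using g by (intro member_le_sum_list) auto
    then have "g [^] (p ^ m) = (g [^] (p ^ n g)) [^] (p ^ (m - n g))"
      using gc by (simp add: nat_pow_pow flip: power_add)
    moreover have "(g [^] (p ^ n g)) [^] (p ^ (m - n g)) \<in> generate G {g [^] (p ^ n g)}"
      using gc by (intro nat_pow_mem_generate) auto
    ultimately have "generate G {g [^] (p ^ m)} \<subseteq> generate G {g [^] (p ^ n g)}"
      using gc by (intro generate_subgroup_incl generate_is_subgroup) auto
    then have "procyclic (g [^] (p ^ m)) \<subseteq> procyclic (g [^] (p ^ n g))"
      unfolding procyclic_def by (rule closure_of_mono)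
    then show ?thesis using n[OF gc] by blast
  qed
  then have "foldr (\<lambda>g S. procyclic (g [^] (p ^ m)) <#> S) gs {\<one>} \<subseteq> K"
    using K(1) by (intro foldr_set_mult_subset_subgroup)
  moreover obtain H where "openin T H" "\<one> \<in> H"
      "H \<subseteq> foldr (\<lambda>g S. procyclic (g [^] (p ^ m)) <#> S) gs {\<one>}"
    using powerful_product_neighbourhood[OF p pow gs] by blast
  ultimately show ?thesis
    using K(1) by (intro openin_superset_subgroup[of K H]) auto
qed

end

section \<open>Powers in procyclic pro-\<open>p\<close> groups\<close>

context pro_p_group begin

lemma pow_mem_open_normal:
  assumes "N \<lhd> G" "openin T N"
  shows "\<exists>l. \<forall>g\<in>carrier G. g [^] (p ^ l) \<in> N"
proof -
  interpret N: normal N G by fact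
  interpret F: group "G Mod N" by (rule N.factorgroup_is_group)
  obtain l where "card (rcosets N) = p ^ l" using index_open_normal assms by blast
  then have ord: "order (G Mod N) = p ^ l" by (simp add: order_def FactGroup_def)
  have "g [^] (p ^ l) \<in> N" if g: "g \<in> carrier G" for g
  proof -
    have "(N #> g) [^]\<^bsub>G Mod N\<^esub> (p ^ l) = \<one>\<^bsub>G Mod N\<^esub>"
      using F.pow_order_eq_1[of "N #> g"] g ord by (auto simp: carrier_FactGroup)
    then show ?thesis using g by (simp add: N.FactGroup_pow N.rcos_eq_self_iff)
  qed
  then show ?thesis by blast
qed

text \<open>
  The factor \<open>m'\<close> is invertible modulo every power of \<open>p\<close>. So each power of \<open>g\<close> with exponent
  divisible by \<open>p\<^sup>a\<close> is congruent to an \<open>m\<close>-th power of a power of \<open>g\<close> modulo any open normal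
  subgroup, and the set of \<open>m\<close>-th powers is closed.
\<close>

lemma procyclic_pow_subset_image_pow:
  assumes p: "Factorial_Ring.prime p" and g: "g \<in> carrier G"
    and m: "m = p ^ a * m'" "coprime p m'"
  shows "procyclic (g [^] (p ^ a)) \<subseteq> (\<lambda>y. y [^] m) ` procyclic g"
proof -
  let ?D = "(\<lambda>y. y [^] m) ` procyclic g"
  have "compactin T (procyclic g)"
    unfolding procyclic_def by (intro closedin_compact_space compact closedin_closure_of)
  then have "compactin T ?D"
    using continuous_map_nat_pow by (rule image_compactin)
  then have D_closed: "closedin T ?D"
    using Hausdorff by (rule compactin_imp_closedin[rotated])
  have "z \<in> T closure_of ?D" if z: "z \<in> generate G {g [^] (p ^ a)}" for z
  proof -
    obtain k :: int where k: "z = (g [^] (p ^ a)) [^] k"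
      using z g generate_pow[of "g [^] (p ^ a)"] by auto
    have z_eq: "z = g [^] (int (p ^ a) * k)"
      using g by (simp add: k int_pow_pow flip: int_pow_int)
    have zc: "z \<in> carrier G" using g by (simp add: z_eq)
    show ?thesis
      unfolding in_closure_of
    proof (intro conjI allI impI)
      show "z \<in> topspace T" using zc by (simp add: topspace_eq_carrier)
      fix W assume W: "z \<in> W \<and> openin T W"
      have "openin T (inv z <# W)" using W zc by (intro openin_l_coset) auto
      moreover have "\<one> \<in> inv z <# W" using W zc by (force simp: l_coset_def)
      ultimately obtain N where N: "N \<lhd> G" "openin T N" "N \<subseteq> inv z <# W"
        using open_normal_base by blast
      interpret N: normal N G by fact
      obtain l where l: "\<And>g. g \<in> carrier G \<Longrightarrow> g [^] (p ^ l) \<in> N"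
        using pow_mem_open_normal[OF N(1,2)] by blast
      have "gcd (int m') (int (p ^ l)) = 1"
        using m(2) by (simp add: coprime_commute flip: coprime_iff_gcd_eq_1)
      then obtain u v :: int where uv: "u * int m' + v * int (p ^ l) = 1"
        using bezout_int[of "int m'" "int (p ^ l)"] by auto
      \<comment> \<open>Since \<open>u\<close> inverts \<open>m'\<close> modulo \<open>p\<^sup>l\<close>, this \<open>j\<close> satisfies \<open>j * m' = k\<close> modulo \<open>p\<^sup>l\<close>.\<close>
      define j where "j = nat ((u * k) mod int (p ^ l))"
      have p0: "int (p ^ l) > 0" using prime_gt_0_nat[OF p] by simp
      have "int j = u * k - int (p ^ l) * (u * k div int (p ^ l))"
        using p0 by (simp add: j_def minus_mult_div_eq_mod)
      then obtain t where t: "int j = u * k - int (p ^ l) * t" by blast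
      define s where "s = - (k * v + t * int m')"
      have "int j * int m' - k = k * (u * int m' + v * int (p ^ l) - 1) + int (p ^ l) * s"
        unfolding t s_def by (simp add: algebra_simps)
      then have j: "int j * int m' - k = int (p ^ l) * s"
        unfolding uv by simp
      let ?y = "g [^] j"
      have "inv z \<otimes> ?y [^] m = g [^] (- (int (p ^ a) * k)) \<otimes> g [^] (int (j * m))"
        using g by (simp add: z_eq int_pow_neg nat_pow_pow int_pow_int del: of_nat_mult)
      also have "\<dots> = g [^] (- (int (p ^ a) * k) + int (j * m))"
        by (rule int_pow_mult[OF g, symmetric])
      also have "- (int (p ^ a) * k) + int (j * m) = int (p ^ a) * (int j * int m' - k)"
        by (simp add: m(1) algebra_simps)
      also have "\<dots> = int (p ^ l) * (int (p ^ a) * s)"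
        by (simp add: j)
      also have "g [^] (int (p ^ l) * (int (p ^ a) * s)) = (g [^] (p ^ l)) [^] (int (p ^ a) * s)"
        using g by (simp add: int_pow_pow flip: int_pow_int)
      also have "\<dots> \<in> N"
        using l[OF g] by (intro subgroup_int_pow_closed N.is_subgroup)
      finally have "inv z \<otimes> ?y [^] m \<in> inv z <# W" using N(3) by blast
      then obtain w where w: "w \<in> W" "inv z \<otimes> ?y [^] m = inv z \<otimes> w" by (auto simp: l_coset_def)
      have "w \<in> carrier G" using w W openin_subset_carrier by blast
      then have "?y [^] m = w" using w g zc by simp
      moreover have "?y [^] m \<in> ?D" using nat_pow_mem_procyclic[OF g] by blast
      ultimately show "\<exists>y. y \<in> ?D \<and> y \<in> W" using w by blast
    qed
  qed
  then have "generate G {g [^] (p ^ a)} \<subseteq> ?D"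
    using D_closed by (auto simp: closure_of_closedin)
  then show ?thesis
    unfolding procyclic_def[of "g [^] (p ^ a)"] using D_closed by (rule closure_of_minimal)
qed

corollary procyclic_pow_add_subset_image_pow:
  assumes "Factorial_Ring.prime p" "g \<in> carrier G" "m = p ^ a * m'" "coprime p m'"
  shows "procyclic (g [^] (p ^ (n + a))) \<subseteq> (\<lambda>y. y [^] m) ` procyclic (g [^] (p ^ n))"
  using procyclic_pow_subset_image_pow[of "g [^] (p ^ n)" m a m'] assms
  by (simp add: nat_pow_pow power_add)

end

section \<open>Cocycles with values in smooth representations\<close>

context group_representation begin

text \<open>
  The multiple \<open>m v\<close> is the scalar multiple of \<open>v\<close> by \<open>m \<cdot> 1 = 0\<close>.
\<close>

lemma torsion:
  assumes "ring_characteristic K = m" "v \<in> carrier V"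
  shows "[m] \<cdot>\<^bsub>V\<^esub> v = \<zero>\<^bsub>V\<^esub>"
proof -
  have "[n] \<cdot>\<^bsub>V\<^esub> v = ([n] \<cdot>\<^bsub>K\<^esub> \<one>\<^bsub>K\<^esub>) \<odot>\<^bsub>V\<^esub> v" for n :: nat
    using assms(2) by (induction n) (simp_all add: smult_l_distr)
  moreover have "[m] \<cdot>\<^bsub>K\<^esub> \<one>\<^bsub>K\<^esub> = \<zero>\<^bsub>K\<^esub>"
    using R.add.pow_ord_eq_1[of "\<one>\<^bsub>K\<^esub>"] assms(1)
    by (simp add: ring_characteristic_def add_pow_def)
  ultimately show ?thesis using assms(2) by simp
qed

lemma action_one: "v \<in> carrier V \<Longrightarrow> \<rho> \<one>\<^bsub>G\<^esub> v = v"
  using id_eq_one by (metis restrict_apply')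

lemma action_closed: "g \<in> carrier G \<Longrightarrow> v \<in> carrier V \<Longrightarrow> \<rho> g v \<in> carrier V"
  using element_image by blast

lemma action_zero:
  assumes "g \<in> carrier G"
  shows "\<rho> g \<zero>\<^bsub>V\<^esub> = \<zero>\<^bsub>V\<^esub>"
  using action_add[OF assms, of "\<zero>\<^bsub>V\<^esub>" "\<zero>\<^bsub>V\<^esub>"] action_closed[OF assms, of "\<zero>\<^bsub>V\<^esub>"] by simp

lemma action_minus:
  assumes "g \<in> carrier G" "v \<in> carrier V"
  shows "\<rho> g (\<ominus>\<^bsub>V\<^esub> v) = \<ominus>\<^bsub>V\<^esub> \<rho> g v"
proof -
  have "\<rho> g v \<oplus>\<^bsub>V\<^esub> \<rho> g (\<ominus>\<^bsub>V\<^esub> v) = \<zero>\<^bsub>V\<^esub>"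
    using action_add[OF assms(1), of v "\<ominus>\<^bsub>V\<^esub> v"] assms action_zero by (simp add: M.r_neg)
  then show ?thesis
    using assms action_closed by (metis M.a_inv_closed M.minus_equality M.a_comm)
qed

end

lemma group_representation_subgroup:
  assumes "group_representation K G V \<rho>" "subgroup U G"
  shows "group_representation K (G\<lparr>carrier := U\<rparr>) V \<rho>"
proof -
  interpret group_representation K G V \<rho> by fact
  interpret hom: group_hom G "BijGroup (carrier V)" \<rho> by (rule group_hom)
  have U: "u \<in> carrier G" if "u \<in> U" for u
    using that assms(2) by (rule subgroup.mem_carrier[rotated])
  have "group_action (G\<lparr>carrier := U\<rparr>) (carrier V) \<rho>"
    unfolding group_action_def group_hom_def group_hom_axioms_def hom_def
    using U hom.hom_closed hom.hom_mult hom.H.group_axioms assms(2)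
    by (auto intro: subgroup.subgroup_is_group hom.G.group_axioms)
  then show ?thesis
    using U action_add action_smult module_axioms
    by (simp add: group_representation_def group_representation_axioms_def)
qed

lemma smooth_representation_subgroup:
  assumes "smooth_representation K G T V \<rho>" "subgroup U G"
    and "topological_group (G\<lparr>carrier := U\<rparr>) (subtopology T U)"
  shows "smooth_representation K (G\<lparr>carrier := U\<rparr>) (subtopology T U) V \<rho>"
proof -
  interpret smooth_representation K G T V \<rho> by fact
  have "continuous_map (prod_topology (subtopology T U) (discrete_topology (carrier V)))
      (discrete_topology (carrier V)) (\<lambda>(g, v). \<rho> g v)"
    using continuous_map_from_subtopology[OF smooth, of "U \<times> carrier V"]
    by (simp add: prod_topology_subtopology)
  then show ?thesis
    using assms(3) group_representation_subgroup[OF group_representation_axioms assms(2)]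
    by (simp add: smooth_representation_def smooth_representation_axioms_def)
qed

context smooth_representation begin

lemma openin_stabilizer:
  assumes "v \<in> carrier V"
  shows "openin T (stabilizer G \<rho> v)"
proof -
  have "continuous_map T (prod_topology T (discrete_topology (carrier V))) (\<lambda>g. (g, v))"
    using assms by (intro continuous_map_pairedI continuous_map_id[unfolded id_def]) auto
  then have "continuous_map T (discrete_topology (carrier V)) (\<lambda>g. \<rho> g v)"
    using continuous_map_compose[OF _ smooth] by (fastforce simp: o_def)
  then have "openin T {g \<in> topspace T. \<rho> g v \<in> {v}}"
    using assms by (intro openin_continuous_map_preimage) auto
  then show ?thesis
    by (simp add: stabilizer_def topspace_eq_carrier)
qed

lemma closedin_stabilizer: "v \<in> carrier V \<Longrightarrow> closedin T (stabilizer G \<rho> v)"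
  using openin_stabilizer stabilizer_subgroup by (intro open_subgroup_closed)

lemma procyclic_fixes:
  assumes "v \<in> carrier V" "g \<in> carrier G" "\<rho> g v = v" "y \<in> procyclic g"
  shows "\<rho> y v = v"
proof -
  have "procyclic g \<subseteq> stabilizer G \<rho> v"
    using assms stabilizer_subgroup closedin_stabilizer
    by (intro procyclic_subset) (auto simp: stabilizer_def)
  then show ?thesis using assms(4) by (auto simp: stabilizer_def)
qed

end

locale smooth_cocycle = smooth_representation +
  fixes c
  assumes cocycle: "one_cocycle G V \<rho> c"
begin

lemma c_closed: "g \<in> carrier G \<Longrightarrow> c g \<in> carrier V"
  using cocycle by (auto simp: one_cocycle_def)

lemma c_mult: "g \<in> carrier G \<Longrightarrow> h \<in> carrier G \<Longrightarrow> c (g \<otimes>\<^bsub>G\<^esub> h) = c g \<oplus>\<^bsub>V\<^esub> \<rho> g (c h)"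
  using cocycle by (auto simp: one_cocycle_def)

lemma c_one: "c \<one>\<^bsub>G\<^esub> = \<zero>\<^bsub>V\<^esub>"
  using c_mult[of "\<one>\<^bsub>G\<^esub>" "\<one>\<^bsub>G\<^esub>"] c_closed[of "\<one>\<^bsub>G\<^esub>"] by (simp add: action_one)

definition cocycle_kernel where
  "cocycle_kernel = {g \<in> carrier G. c g = \<zero>\<^bsub>V\<^esub>}"

text \<open>
  A cocycle need not be a homomorphism, but a zero \<open>g\<close> contributes nothing to
  \<open>c (g h) = c g + g c h\<close>, and neither does a zero \<open>h\<close>.
\<close>

lemma subgroup_cocycle_kernel: "subgroup cocycle_kernel G"
proof (rule subgroupI)
  show "cocycle_kernel \<subseteq> carrier G" by (auto simp: cocycle_kernel_def)
  show "cocycle_kernel \<noteq> {}" using c_one by (auto simp: cocycle_kernel_def)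
  fix g assume g: "g \<in> cocycle_kernel"
  then have gc: "g \<in> carrier G" by (simp add: cocycle_kernel_def)
  have "\<zero>\<^bsub>V\<^esub> = c (inv\<^bsub>G\<^esub> g \<otimes>\<^bsub>G\<^esub> g)" using gc c_one by simp
  also have "\<dots> = c (inv\<^bsub>G\<^esub> g) \<oplus>\<^bsub>V\<^esub> \<rho> (inv\<^bsub>G\<^esub> g) (c g)" using gc by (intro c_mult) auto
  also have "\<dots> = c (inv\<^bsub>G\<^esub> g)" using g c_closed by (simp add: cocycle_kernel_def action_zero)
  finally show "inv\<^bsub>G\<^esub> g \<in> cocycle_kernel" using gc by (simp add: cocycle_kernel_def)
  fix h assume h: "h \<in> cocycle_kernel"
  then show "g \<otimes>\<^bsub>G\<^esub> h \<in> cocycle_kernel"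
    using g by (simp add: cocycle_kernel_def c_mult action_zero)
qed

lemma continuous_if_kernel_open:
  assumes "openin T cocycle_kernel"
  shows "continuous_map T (discrete_topology (carrier V)) c"
  unfolding continuous_map_openin_preimage_eq
proof (intro conjI allI impI)
  show "c \<in> topspace T \<rightarrow> topspace (discrete_topology (carrier V))"
    using c_closed by (auto simp: topspace_eq_carrier)
  fix S
  show "openin T (topspace T \<inter> c -` S)"
  proof (subst openin_subopen, intro ballI exI conjI)
    fix g assume g: "g \<in> topspace T \<inter> c -` S"
    then have gc: "g \<in> carrier G" by (simp add: topspace_eq_carrier)
    show "openin T (g <#\<^bsub>G\<^esub> cocycle_kernel)" using assms gc by (rule openin_l_coset)
    show "g \<in> g <#\<^bsub>G\<^esub> cocycle_kernel"
      using gc subgroup.one_closed[OF subgroup_cocycle_kernel] by (rule mem_l_coset_self)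
    show "g <#\<^bsub>G\<^esub> cocycle_kernel \<subseteq> topspace T \<inter> c -` S"
      using g gc c_closed
      by (auto simp: l_coset_def cocycle_kernel_def topspace_eq_carrier c_mult action_zero)
  qed
qed

text \<open>
  For \<open>y\<close> in a small procyclic group \<open>C\<close> commuting with \<open>g\<close>, the equation \<open>c (g y) = c (y g)\<close>
  forces \<open>g\<close> to fix \<open>c y\<close>. Then \<open>c\<close> is additive on the powers of \<open>y\<close> and vanishes at \<open>y\<^sup>m\<close>.
\<close>

lemma procyclic_subset_kernel:
  assumes p: "Factorial_Ring.prime p" and pro_p: "pro_p_group p G T"
    and m: "ring_characteristic K = m" "m > 0" and g: "g \<in> carrier G"
  shows "\<exists>n. procyclic (g [^]\<^bsub>G\<^esub> (p ^ n)) \<subseteq> cocycle_kernel"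
proof -
  interpret pro_p_group p G T by fact
  have S: "openin T (stabilizer G \<rho> (c g))" "\<one>\<^bsub>G\<^esub> \<in> stabilizer G \<rho> (c g)"
    using g c_closed openin_stabilizer stabilizer_one_closed by auto
  obtain N where N: "N \<lhd> G" "openin T N" "N \<subseteq> stabilizer G \<rho> (c g)"
    using open_normal_base[OF S] by blast
  obtain n where n: "g [^]\<^bsub>G\<^esub> (p ^ n) \<in> N"
    using pow_mem_open_normal[OF N(1,2)] g by blast
  let ?C = "procyclic (g [^]\<^bsub>G\<^esub> (p ^ n))"
  have C_S: "?C \<subseteq> stabilizer G \<rho> (c g)"
    using n N g c_closed stabilizer_subgroup closedin_stabilizer by (intro procyclic_subset) auto
  have C_g: "?C \<subseteq> procyclic g" using g by (rule procyclic_nat_pow_subset)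
  \<comment> \<open>Compare the values of \<open>c\<close> at \<open>g y\<close> and \<open>y g\<close>, using that \<open>y\<close> fixes \<open>c g\<close>.\<close>
  have fixed: "\<rho> y (c y) = c y" if y: "y \<in> ?C" for y
  proof -
    have yc: "y \<in> carrier G" and y_v: "\<rho> y (c g) = c g"
      using y C_S by (auto simp: stabilizer_def)
    have "c g \<oplus>\<^bsub>V\<^esub> \<rho> g (c y) = c (g \<otimes>\<^bsub>G\<^esub> y)" using g yc by (simp add: c_mult)
    also have "g \<otimes>\<^bsub>G\<^esub> y = y \<otimes>\<^bsub>G\<^esub> g"
      using procyclic_commutes[OF Hausdorff g] y C_g by blast
    also have "c (y \<otimes>\<^bsub>G\<^esub> g) = c g \<oplus>\<^bsub>V\<^esub> c y"
      using g yc y_v c_closed by (simp add: c_mult M.a_comm)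
    finally have "\<rho> g (c y) = c y"
      using g yc c_closed action_closed by simp
    then show ?thesis
      using procyclic_fixes[of "c y" g y] g yc c_closed y C_g by blast
  qed
  have c_pow: "c (y [^]\<^bsub>G\<^esub> k) = [k] \<cdot>\<^bsub>V\<^esub> c y" if y: "y \<in> ?C" for y and k :: nat
  proof -
    have yc: "y \<in> carrier G" using y C_S by (auto simp: stabilizer_def)
    have "y [^]\<^bsub>G\<^esub> k \<in> stabilizer G \<rho> (c y)" for k :: nat
      using yc fixed[OF y] c_closed
      by (intro subgroup_nat_pow_closed stabilizer_subgroup) (auto simp: stabilizer_def)
    then have pow_fix: "\<rho> (y [^]\<^bsub>G\<^esub> k) (c y) = c y" for k :: nat
      by (auto simp: stabilizer_def)
    show ?thesis
      by (induction k) (use yc pow_fix in \<open>simp_all add: c_one c_mult\<close>)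
  qed
  obtain a m' where m': "m = p ^ a * m'" "coprime p m'"
  proof -
    obtain m' where "m = p ^ multiplicity p m * m'" "\<not> p dvd m'"
      by (rule multiplicity_decompose'[of m p]) (use m p in auto)
    then show ?thesis
      using that prime_imp_coprime[OF p] by blast
  qed
  have "procyclic (g [^]\<^bsub>G\<^esub> (p ^ (n + a))) \<subseteq> (\<lambda>y. y [^]\<^bsub>G\<^esub> m) ` ?C"
    using p g m' by (rule procyclic_pow_add_subset_image_pow)
  also have "\<dots> \<subseteq> cocycle_kernel"
  proof
    fix z assume "z \<in> (\<lambda>y. y [^]\<^bsub>G\<^esub> m) ` ?C"
    then obtain y where y: "y \<in> ?C" "z = y [^]\<^bsub>G\<^esub> m" by blast
    then have yc: "y \<in> carrier G" using C_S by (auto simp: stabilizer_def)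
    then show "z \<in> cocycle_kernel"
      using y c_pow[OF y(1)] torsion[OF m(1)] c_closed by (simp add: cocycle_kernel_def)
  qed
  finally show ?thesis by blast
qed

end

text \<open>
  The zeros of the restriction of \<open>c\<close> to the powerful pro-\<open>p\<close> subgroup \<open>U\<close> are open in \<open>U\<close>, hence
  form a neighbourhood of the identity in \<open>G\<close>.
\<close>

theorem one_cocycle_continuous:
  assumes p: "Factorial_Ring.prime p" and G: "p_adic_analytic_group p G T"
    and V: "smooth_representation K G T V \<rho>"
    and m: "ring_characteristic K = m" "m > 0"
    and c: "one_cocycle G V \<rho> c"
  shows "continuous_map T (discrete_topology (carrier V)) c"
proof -
  obtain U where U: "subgroup U G" "openin T U"
    and pro_p: "pro_p_group p (G\<lparr>carrier := U\<rparr>) (subtopology T U)"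
    and fg: "topologically_finitely_generated (G\<lparr>carrier := U\<rparr>) (subtopology T U)"
    and pow: "powerful p (G\<lparr>carrier := U\<rparr>) (subtopology T U)"
    using G unfolding p_adic_analytic_group_def by blast
  interpret U: pro_p_group p "G\<lparr>carrier := U\<rparr>" "subtopology T U" by fact
  interpret G: smooth_cocycle K G T V \<rho> c
    by (intro smooth_cocycle.intro smooth_cocycle_axioms.intro V c)
  have "one_cocycle (G\<lparr>carrier := U\<rparr>) V \<rho> c"
    using c subgroup.mem_carrier[OF U(1)] by (auto simp: one_cocycle_def)
  then have "smooth_cocycle K (G\<lparr>carrier := U\<rparr>) (subtopology T U) V \<rho> c"
    using smooth_representation_subgroup[OF V U(1) U.topological_group_axioms]
    by (simp add: smooth_cocycle_def smooth_cocycle_axioms_def)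
  then interpret res: smooth_cocycle K "G\<lparr>carrier := U\<rparr>" "subtopology T U" V \<rho> c .
  have "openin (subtopology T U) res.cocycle_kernel"
    using res.procyclic_subset_kernel[OF p pro_p m] res.subgroup_cocycle_kernel
    by (intro U.subgroup_containing_procyclic_open[OF p pow fg])
  then have "openin T res.cocycle_kernel"
    using U(2) by (rule openin_trans_full)
  moreover have "\<one>\<^bsub>G\<^esub> \<in> res.cocycle_kernel"
    using subgroup.one_closed[OF res.subgroup_cocycle_kernel] by simp
  moreover have "res.cocycle_kernel \<subseteq> G.cocycle_kernel"
    using subgroup.mem_carrier[OF U(1)]
    by (auto simp: res.cocycle_kernel_def G.cocycle_kernel_def)
  ultimately have "openin T G.cocycle_kernel"
    by (rule G.openin_superset_subgroup[OF G.subgroup_cocycle_kernel])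
  then show ?thesis by (rule G.continuous_if_kernel_open)
qed

section \<open>Cohomology in degree one\<close>

definition singleton_tuple :: "'g \<Rightarrow> nat \<Rightarrow> 'g" where
  "singleton_tuple g = (\<lambda>i\<in>{..<1}. g)"

lemma singleton_tuple_mem: "g \<in> carrier G \<Longrightarrow> singleton_tuple g \<in> tuples G 1"
  by (auto simp: singleton_tuple_def tuples_def)

lemma singleton_tuple_0 [simp]: "singleton_tuple g 0 = g"
  by (simp add: singleton_tuple_def)

lemma tuples_1: "x \<in> tuples G 1 \<Longrightarrow> x = singleton_tuple (x 0) \<and> x 0 \<in> carrier G"
  by (auto simp: singleton_tuple_def tuples_def PiE_iff extensional_def restrict_def fun_eq_iff)

lemma tuples_mem: "x \<in> tuples G q \<Longrightarrow> i < q \<Longrightarrow> x i \<in> carrier G"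
  by (simp add: tuples_def PiE_iff)

lemma tuples_0: "tuples G 0 = {\<lambda>_. undefined}"
  by (simp add: tuples_def)

text \<open>
  There is only one empty tuple.
\<close>

lemma cochains_cont_0: "cochains_cont G T V 0 = cochains_abs G V 0"
  by (auto simp: cochains_cont_def cochains_abs_def tuples_0 product_topology_empty_discrete
      PiE_iff extensional_def)

lemma face_0: "face G 0 i x = (\<lambda>_. undefined)"
  by (simp add: face_def fun_eq_iff)

lemma face_1:
  "face G 1 0 x = singleton_tuple (x 1)" "face G 1 1 x = singleton_tuple (x 0 \<otimes>\<^bsub>G\<^esub> x 1)"
  "face G 1 2 x = singleton_tuple (x 0)"
  by (auto simp: face_def singleton_tuple_def fun_eq_iff)

context group_representation begin

lemma coboundary_map_0:
  assumes "f \<in> cochains_abs G V 0"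
  shows "coboundary_map G V \<rho> 0 f
    = (\<lambda>x\<in>tuples G 1. \<rho> (x 0) (f (\<lambda>_. undefined)) \<ominus>\<^bsub>V\<^esub> f (\<lambda>_. undefined))"
proof -
  have "f (\<lambda>_. undefined) \<in> carrier V"
    using assms by (auto simp: cochains_abs_def tuples_0)
  then show ?thesis
    by (simp add: coboundary_map_def face_0 a_minus_def)
qed

lemma coboundary_map_1:
  assumes "f \<in> cochains_abs G V 1" "x \<in> tuples G 2"
  shows "coboundary_map G V \<rho> 1 f x = \<rho> (x 0) (f (singleton_tuple (x 1))) \<oplus>\<^bsub>V\<^esub>
    (\<ominus>\<^bsub>V\<^esub> f (singleton_tuple (x 0 \<otimes>\<^bsub>G\<^esub> x 1)) \<oplus>\<^bsub>V\<^esub> f (singleton_tuple (x 0)))"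
proof -
  interpret hom: group_hom G "BijGroup (carrier V)" \<rho> by (rule group_hom)
  have x: "x 0 \<in> carrier G" "x 1 \<in> carrier G"
    using tuples_mem[OF assms(2)] by simp_all
  have f: "f (singleton_tuple g) \<in> carrier V" if "g \<in> carrier G" for g
    using assms(1) singleton_tuple_mem[OF that] by (auto simp: cochains_abs_def)
  have ivl: "{1..Suc 1} = {1, 2 :: nat}" by auto
  have mult: "x 0 \<otimes>\<^bsub>G\<^esub> x 1 \<in> carrier G"
    using x by (rule hom.G.m_closed)
  have finsum: "(\<Oplus>\<^bsub>V\<^esub>i\<in>{1, 2 :: nat}. t i) = t 1 \<oplus>\<^bsub>V\<^esub> t 2"
    if "t 1 \<in> carrier V" "t 2 \<in> carrier V" for t
    using that by (subst M.finsum_insert) auto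
  have "coboundary_map G V \<rho> 1 f x = \<rho> (x 0) (f (face G 1 0 x)) \<oplus>\<^bsub>V\<^esub>
      (\<Oplus>\<^bsub>V\<^esub>i\<in>{1, 2}. if even i then f (face G 1 i x) else \<ominus>\<^bsub>V\<^esub> f (face G 1 i x))"
    using assms(2) unfolding coboundary_map_def ivl by (simp add: numeral_2_eq_2)
  then show ?thesis
    using f x mult by (subst (asm) finsum) (auto simp: face_1[unfolded One_nat_def])
qed

lemma cocycle_iff_one_cocycle:
  assumes f: "f \<in> cochains_abs G V 1"
  shows "coboundary_map G V \<rho> 1 f = (\<lambda>x\<in>tuples G (Suc 1). \<zero>\<^bsub>V\<^esub>)
    \<longleftrightarrow> one_cocycle G V \<rho> (\<lambda>g. f (singleton_tuple g))"
proof -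
  interpret hom: group_hom G "BijGroup (carrier V)" \<rho> by (rule group_hom)
  have fc: "f (singleton_tuple g) \<in> carrier V" if "g \<in> carrier G" for g
    using f singleton_tuple_mem[OF that] by (auto simp: cochains_abs_def)
  have eq: "u \<oplus>\<^bsub>V\<^esub> (\<ominus>\<^bsub>V\<^esub> v \<oplus>\<^bsub>V\<^esub> w) = \<zero>\<^bsub>V\<^esub> \<longleftrightarrow> v = w \<oplus>\<^bsub>V\<^esub> u"
    if "u \<in> carrier V" "v \<in> carrier V" "w \<in> carrier V" for u v w
  proof -
    have "u \<oplus>\<^bsub>V\<^esub> (\<ominus>\<^bsub>V\<^esub> v \<oplus>\<^bsub>V\<^esub> w) = \<ominus>\<^bsub>V\<^esub> v \<oplus>\<^bsub>V\<^esub> (w \<oplus>\<^bsub>V\<^esub> u)"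
      using that by (simp add: M.a_ac)
    moreover have "v \<oplus>\<^bsub>V\<^esub> (\<ominus>\<^bsub>V\<^esub> v \<oplus>\<^bsub>V\<^esub> (w \<oplus>\<^bsub>V\<^esub> u)) = w \<oplus>\<^bsub>V\<^esub> u"
      using that by (simp add: M.r_neg2)
    ultimately show ?thesis
      using that by (metis M.add.m_closed M.l_neg M.r_zero)
  qed
  have "coboundary_map G V \<rho> 1 f = (\<lambda>x\<in>tuples G (Suc 1). \<zero>\<^bsub>V\<^esub>)
      \<longleftrightarrow> (\<forall>x\<in>tuples G 2. coboundary_map G V \<rho> 1 f x = \<zero>\<^bsub>V\<^esub>)"
    by (auto simp: coboundary_map_def fun_eq_iff numeral_2_eq_2)
  also have "\<dots> \<longleftrightarrow> (\<forall>x\<in>tuples G 2. f (singleton_tuple (x 0 \<otimes>\<^bsub>G\<^esub> x 1))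
      = f (singleton_tuple (x 0)) \<oplus>\<^bsub>V\<^esub> \<rho> (x 0) (f (singleton_tuple (x 1))))"
  proof (rule ball_cong[OF refl])
    fix x assume x: "x \<in> tuples G 2"
    then have "x 0 \<in> carrier G" "x 1 \<in> carrier G"
      using tuples_mem by fastforce+
    then show "coboundary_map G V \<rho> 1 f x = \<zero>\<^bsub>V\<^esub> \<longleftrightarrow> f (singleton_tuple (x 0 \<otimes>\<^bsub>G\<^esub> x 1))
      = f (singleton_tuple (x 0)) \<oplus>\<^bsub>V\<^esub> \<rho> (x 0) (f (singleton_tuple (x 1)))"
      unfolding coboundary_map_1[OF f x] by (intro eq) (auto simp: fc action_closed)
  qed
  also have "\<dots> \<longleftrightarrow> one_cocycle G V \<rho> (\<lambda>g. f (singleton_tuple g))"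
  proof
    assume *: "\<forall>x\<in>tuples G 2. f (singleton_tuple (x 0 \<otimes>\<^bsub>G\<^esub> x 1))
      = f (singleton_tuple (x 0)) \<oplus>\<^bsub>V\<^esub> \<rho> (x 0) (f (singleton_tuple (x 1)))"
    show "one_cocycle G V \<rho> (\<lambda>g. f (singleton_tuple g))"
      unfolding one_cocycle_def
    proof (intro conjI ballI)
      fix g h assume gh: "g \<in> carrier G" "h \<in> carrier G"
      then have "(\<lambda>i\<in>{..<2 :: nat}. if i = 0 then g else h) \<in> tuples G 2"
        by (auto simp: tuples_def)
      from bspec[OF * this] show "f (singleton_tuple (g \<otimes>\<^bsub>G\<^esub> h))
          = f (singleton_tuple g) \<oplus>\<^bsub>V\<^esub> \<rho> g (f (singleton_tuple h))"
        by simp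
    qed (use fc in auto)
  next
    assume "one_cocycle G V \<rho> (\<lambda>g. f (singleton_tuple g))"
    then show "\<forall>x\<in>tuples G 2. f (singleton_tuple (x 0 \<otimes>\<^bsub>G\<^esub> x 1))
      = f (singleton_tuple (x 0)) \<oplus>\<^bsub>V\<^esub> \<rho> (x 0) (f (singleton_tuple (x 1)))"
      using tuples_mem[of _ G 2 0] tuples_mem[of _ G 2 1] by (simp add: one_cocycle_def)
  qed
  finally show ?thesis .
qed

abbreviation Z where "Z \<equiv> cocycle_group G V \<rho> (cochains_abs G V) 1"

lemma carrier_Z: "f \<in> carrier Z \<longleftrightarrow>
    f \<in> cochains_abs G V 1 \<and> one_cocycle G V \<rho> (\<lambda>g. f (singleton_tuple g))"
  using cocycle_iff_one_cocycle by (auto simp: cocycle_group_def)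

lemma one_cocycle_zero: "one_cocycle G V \<rho> (\<lambda>_. \<zero>\<^bsub>V\<^esub>)"
  by (simp add: one_cocycle_def action_zero)

lemma one_cocycle_add:
  assumes "one_cocycle G V \<rho> c" "one_cocycle G V \<rho> d"
  shows "one_cocycle G V \<rho> (\<lambda>g. c g \<oplus>\<^bsub>V\<^esub> d g)"
  unfolding one_cocycle_def
proof (intro conjI ballI)
  have cd: "c g \<in> carrier V" "d g \<in> carrier V" if "g \<in> carrier G" for g
    using assms that by (auto simp: one_cocycle_def)
  then show "(\<lambda>g. c g \<oplus>\<^bsub>V\<^esub> d g) \<in> carrier G \<rightarrow> carrier V" by simp
  fix g h assume gh: "g \<in> carrier G" "h \<in> carrier G"
  have "c (g \<otimes>\<^bsub>G\<^esub> h) = c g \<oplus>\<^bsub>V\<^esub> \<rho> g (c h)" "d (g \<otimes>\<^bsub>G\<^esub> h) = d g \<oplus>\<^bsub>V\<^esub> \<rho> g (d h)"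
    using assms gh by (auto simp: one_cocycle_def)
  then show "c (g \<otimes>\<^bsub>G\<^esub> h) \<oplus>\<^bsub>V\<^esub> d (g \<otimes>\<^bsub>G\<^esub> h) = c g \<oplus>\<^bsub>V\<^esub> d g \<oplus>\<^bsub>V\<^esub> \<rho> g (c h \<oplus>\<^bsub>V\<^esub> d h)"
    using gh cd by (simp add: action_add action_closed M.a_ac)
qed

lemma one_cocycle_minus:
  assumes "one_cocycle G V \<rho> c"
  shows "one_cocycle G V \<rho> (\<lambda>g. \<ominus>\<^bsub>V\<^esub> c g)"
proof -
  have "c g \<in> carrier V" if "g \<in> carrier G" for g
    using assms that by (auto simp: one_cocycle_def)
  then show ?thesis
    using assms by (auto simp: one_cocycle_def action_minus action_closed M.minus_add)
qed

lemma one_cocycle_principal: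
  assumes v: "v \<in> carrier V"
  shows "one_cocycle G V \<rho> (\<lambda>g. \<rho> g v \<ominus>\<^bsub>V\<^esub> v)"
  unfolding one_cocycle_def
proof (intro conjI ballI)
  show "(\<lambda>g. \<rho> g v \<ominus>\<^bsub>V\<^esub> v) \<in> carrier G \<rightarrow> carrier V"
    using v action_closed by auto
  fix g h assume gh: "g \<in> carrier G" "h \<in> carrier G"
  let ?a = "\<rho> g v" and ?b = "\<rho> g (\<rho> h v)"
  have carr: "?a \<in> carrier V" "?b \<in> carrier V" using gh v action_closed by auto
  have "?a \<ominus>\<^bsub>V\<^esub> v \<oplus>\<^bsub>V\<^esub> \<rho> g (\<rho> h v \<ominus>\<^bsub>V\<^esub> v) = (?a \<oplus>\<^bsub>V\<^esub> \<ominus>\<^bsub>V\<^esub> ?a) \<oplus>\<^bsub>V\<^esub> (?b \<oplus>\<^bsub>V\<^esub> \<ominus>\<^bsub>V\<^esub> v)"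
    using gh v carr by (simp only: a_minus_def action_add action_closed action_minus M.a_inv_closed
        M.a_closed M.a_ac)
  also have "\<dots> = ?b \<ominus>\<^bsub>V\<^esub> v" using v carr by (simp add: M.r_neg a_minus_def)
  finally show "\<rho> (g \<otimes>\<^bsub>G\<^esub> h) v \<ominus>\<^bsub>V\<^esub> v = \<rho> g v \<ominus>\<^bsub>V\<^esub> v \<oplus>\<^bsub>V\<^esub> \<rho> g (\<rho> h v \<ominus>\<^bsub>V\<^esub> v)"
    using gh v by (simp add: composition_rule)
qed

lemma Z_closed: "f \<in> carrier Z \<Longrightarrow> x \<in> tuples G 1 \<Longrightarrow> f x \<in> carrier V"
  unfolding carrier_Z cochains_abs_def by blast

lemma Z_memI:
  assumes c: "one_cocycle G V \<rho> c" and f: "f \<in> extensional (tuples G 1)"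
    "\<And>x. x \<in> tuples G 1 \<Longrightarrow> f x = c (x 0)"
  shows "f \<in> carrier Z"
proof -
  interpret hom: group_hom G "BijGroup (carrier V)" \<rho> by (rule group_hom)
  have "f (singleton_tuple g) = c g" if "g \<in> carrier G" for g
    using f(2)[OF singleton_tuple_mem[OF that]] by simp
  then have "one_cocycle G V \<rho> (\<lambda>g. f (singleton_tuple g))"
    using c by (auto simp: one_cocycle_def)
  moreover have "f \<in> cochains_abs G V 1"
    unfolding cochains_abs_def PiE_def using f c tuples_1
    by (fastforce simp: one_cocycle_def)
  ultimately show ?thesis by (simp only: carrier_Z)
qed

lemma Z_eval: "f \<in> carrier Z \<Longrightarrow> x \<in> tuples G 1 \<Longrightarrow> f x = f (singleton_tuple (x 0))"
  using tuples_1 by metis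

lemma Z_mult: "f \<otimes>\<^bsub>Z\<^esub> h = (\<lambda>x\<in>tuples G 1. f x \<oplus>\<^bsub>V\<^esub> h x)"
  by (simp add: cocycle_group_def)

lemma Z_one: "\<one>\<^bsub>Z\<^esub> = (\<lambda>x\<in>tuples G 1. \<zero>\<^bsub>V\<^esub>)"
  by (simp add: cocycle_group_def)

lemma Z_comm_group: "comm_group Z"
proof (rule comm_groupI)
  fix f h assume f: "f \<in> carrier Z" and h: "h \<in> carrier Z"
  then have "one_cocycle G V \<rho> (\<lambda>g. f (singleton_tuple g) \<oplus>\<^bsub>V\<^esub> h (singleton_tuple g))"
    unfolding carrier_Z by (intro one_cocycle_add) blast+
  then show "f \<otimes>\<^bsub>Z\<^esub> h \<in> carrier Z"
  proof (rule Z_memI)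
    show "f \<otimes>\<^bsub>Z\<^esub> h \<in> extensional (tuples G 1)" unfolding Z_mult by simp
    show "(f \<otimes>\<^bsub>Z\<^esub> h) x = f (singleton_tuple (x 0)) \<oplus>\<^bsub>V\<^esub> h (singleton_tuple (x 0))"
      if x: "x \<in> tuples G 1" for x
      unfolding Z_mult restrict_apply'[OF x] Z_eval[OF f x] Z_eval[OF h x] ..
  qed
  show "f \<otimes>\<^bsub>Z\<^esub> h = h \<otimes>\<^bsub>Z\<^esub> f"
    unfolding Z_mult using Z_closed[OF f] Z_closed[OF h] by (intro restrict_ext M.a_comm)
  fix k assume k: "k \<in> carrier Z"
  show "f \<otimes>\<^bsub>Z\<^esub> h \<otimes>\<^bsub>Z\<^esub> k = f \<otimes>\<^bsub>Z\<^esub> (h \<otimes>\<^bsub>Z\<^esub> k)"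
    unfolding Z_mult
  proof (rule restrict_ext)
    fix x assume x: "x \<in> tuples G 1"
    show "(\<lambda>x\<in>tuples G 1. f x \<oplus>\<^bsub>V\<^esub> h x) x \<oplus>\<^bsub>V\<^esub> k x = f x \<oplus>\<^bsub>V\<^esub> (\<lambda>x\<in>tuples G 1. h x \<oplus>\<^bsub>V\<^esub> k x) x"
      unfolding restrict_apply'[OF x]
      using Z_closed[OF f x] Z_closed[OF h x] Z_closed[OF k x] by (rule M.a_assoc)
  qed
next
  show "\<one>\<^bsub>Z\<^esub> \<in> carrier Z"
    unfolding Z_one by (rule Z_memI[OF one_cocycle_zero]) simp_all
next
  fix f assume f: "f \<in> carrier Z"
  have "f \<in> extensional (tuples G 1)"
    using f unfolding carrier_Z cochains_abs_def by (auto simp: PiE_def)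
  then show "\<one>\<^bsub>Z\<^esub> \<otimes>\<^bsub>Z\<^esub> f = f"
    unfolding Z_mult Z_one using Z_closed[OF f] by (intro extensionalityI[of _ "tuples G 1"]) simp_all
  have "one_cocycle G V \<rho> (\<lambda>g. \<ominus>\<^bsub>V\<^esub> f (singleton_tuple g))"
    using f unfolding carrier_Z by (intro one_cocycle_minus) blast
  then have "(\<lambda>x\<in>tuples G 1. \<ominus>\<^bsub>V\<^esub> f x) \<in> carrier Z"
  proof (rule Z_memI)
    show "(\<lambda>x\<in>tuples G 1. \<ominus>\<^bsub>V\<^esub> f x) x = \<ominus>\<^bsub>V\<^esub> f (singleton_tuple (x 0))"
      if x: "x \<in> tuples G 1" for x
      unfolding restrict_apply'[OF x] Z_eval[OF f x] ..
  qed simp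
  moreover have "(\<lambda>x\<in>tuples G 1. \<ominus>\<^bsub>V\<^esub> f x) \<otimes>\<^bsub>Z\<^esub> f = \<one>\<^bsub>Z\<^esub>"
    unfolding Z_mult Z_one using Z_closed[OF f] by (intro restrict_ext) (simp add: M.l_neg)
  ultimately show "\<exists>y\<in>carrier Z. y \<otimes>\<^bsub>Z\<^esub> f = \<one>\<^bsub>Z\<^esub>" by blast
qed

lemma coboundaries_1:
  "coboundaries G V \<rho> (cochains_abs G V) 1
    = (\<lambda>v. \<lambda>x\<in>tuples G 1. \<rho> (x 0) v \<ominus>\<^bsub>V\<^esub> v) ` carrier V" (is "_ = ?D ` _")
proof -
  have "coboundary_map G V \<rho> 0 f \<in> ?D ` carrier V" if "f \<in> cochains_abs G V 0" for f
    using coboundary_map_0[OF that] that by (auto simp: cochains_abs_def tuples_0)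
  moreover have "?D v \<in> coboundary_map G V \<rho> 0 ` cochains_abs G V 0" if v: "v \<in> carrier V" for v
  proof -
    have f: "(\<lambda>x\<in>tuples G 0. v) \<in> cochains_abs G V 0"
      using v by (auto simp: cochains_abs_def)
    then show ?thesis
      using coboundary_map_0[OF f] by (force simp: tuples_0)
  qed
  ultimately show ?thesis by auto
qed

lemma coboundaries_subgroup: "subgroup (coboundaries G V \<rho> (cochains_abs G V) 1) Z"
proof -
  interpret Z: comm_group Z by (rule Z_comm_group)
  let ?D = "\<lambda>v. \<lambda>x\<in>tuples G 1. \<rho> (x 0) v \<ominus>\<^bsub>V\<^esub> v"
  have x0: "x 0 \<in> carrier G" if "x \<in> tuples G 1" for x
    using tuples_1 that by blast
  have D_closed: "?D v \<in> carrier Z" if "v \<in> carrier V" for v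
    using one_cocycle_principal[OF that] by (rule Z_memI) auto
  have D_mult: "?D v \<otimes>\<^bsub>Z\<^esub> ?D w = ?D (v \<oplus>\<^bsub>V\<^esub> w)" if "v \<in> carrier V" "w \<in> carrier V" for v w
    unfolding Z_mult using that x0
    by (intro restrict_ext) (simp add: action_add action_closed a_minus_def M.minus_add M.a_ac)
  have D_zero: "?D \<zero>\<^bsub>V\<^esub> = \<one>\<^bsub>Z\<^esub>"
    unfolding Z_one using x0 by (intro restrict_ext) (simp add: action_zero a_minus_def)
  show ?thesis
    unfolding coboundaries_1
  proof (rule Z.subgroupI)
    show "?D ` carrier V \<subseteq> carrier Z" using D_closed by blast
    show "?D ` carrier V \<noteq> {}" by blast
    fix f assume "f \<in> ?D ` carrier V"
    then obtain v where v: "v \<in> carrier V" "f = ?D v" by blast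
    have "?D (\<ominus>\<^bsub>V\<^esub> v) \<otimes>\<^bsub>Z\<^esub> ?D v = \<one>\<^bsub>Z\<^esub>"
      using D_mult[of "\<ominus>\<^bsub>V\<^esub> v" v] D_zero v by (simp add: M.l_neg)
    then have "inv\<^bsub>Z\<^esub> (?D v) = ?D (\<ominus>\<^bsub>V\<^esub> v)"
      using v D_closed by (intro Z.inv_equality) auto
    then show "inv\<^bsub>Z\<^esub> f \<in> ?D ` carrier V" using v by blast
    fix h assume "h \<in> ?D ` carrier V"
    then show "f \<otimes>\<^bsub>Z\<^esub> h \<in> ?D ` carrier V" using D_mult v by blast
  qed
qed

end

text \<open>
  The comparison map sends a class \<open>C\<close> to this union of cosets.
\<close>

lemma (in normal) Union_rcosets_eq:
  assumes "C \<in> carrier (G Mod H)"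
  shows "(\<Union>x\<in>C. H #> x) = C"
proof -
  obtain a where a: "a \<in> carrier G" "C = H #> a"
    using assms by (auto simp: carrier_FactGroup)
  have "H #> x = C" if "x \<in> C" for x
    using repr_independence[OF _ a(1) is_subgroup] that a by blast
  moreover have "C \<noteq> {}" using a rcos_self[OF a(1) is_subgroup] by blast
  ultimately show ?thesis by blast
qed

text \<open>
  The source and the target are equal, and the comparison map is the identity on their carrier.
\<close>

lemma (in group_representation) comparison_map_iso:
  assumes "topological_group G T"
    and cont: "\<And>c. one_cocycle G V \<rho> c \<Longrightarrow> continuous_map T (discrete_topology (carrier V)) c"
  shows "comparison_map G V \<rho> 1 \<in> iso (H_cont G T V \<rho> 1) (H_abs G V \<rho> 1)"
proof -
  interpret topological_group G T by fact
  let ?B = "coboundaries G V \<rho> (cochains_abs G V) 1"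
  interpret Z: comm_group Z by (rule Z_comm_group)
  interpret B: normal ?B Z
    using coboundaries_subgroup by (rule Z.subgroup_imp_normal)
  have "f \<in> cochains_cont G T V 1" if f: "f \<in> carrier Z" for f
  proof -
    have "continuous_map (product_topology (\<lambda>_. T) {..<1 :: nat}) (discrete_topology (carrier V))
        ((\<lambda>g. f (singleton_tuple g)) \<circ> (\<lambda>x. x 0))"
      using f cont unfolding carrier_Z
      by (intro continuous_map_compose[of _ T] continuous_map_product_projection) auto
    then have "continuous_map (product_topology (\<lambda>_. T) {..<1 :: nat}) (discrete_topology (carrier V)) f"
    proof (rule continuous_map_eq)
      fix x assume "x \<in> topspace (product_topology (\<lambda>_. T) {..<1 :: nat})"
      then have "x \<in> tuples G 1" by (simp add: tuples_def topspace_eq_carrier)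
      then show "((\<lambda>g. f (singleton_tuple g)) \<circ> (\<lambda>x. x 0)) x = f x"
        using Z_eval[OF f] by simp
    qed
    then show ?thesis using f unfolding carrier_Z cochains_cont_def by blast
  qed
  then have "carrier (cocycle_group G V \<rho> (cochains_cont G T V) 1) = carrier Z"
    by (auto simp: cocycle_group_def cochains_cont_def)
  then have "cocycle_group G V \<rho> (cochains_cont G T V) 1 = Z"
    by (simp add: cocycle_group_def)
  moreover have "coboundaries G V \<rho> (cochains_cont G T V) 1 = ?B"
    by (simp add: cochains_cont_0)
  ultimately have H_eq: "H_cont G T V \<rho> 1 = H_abs G V \<rho> 1"
    by (simp only: cohomology_def)
  interpret H: group "H_abs G V \<rho> 1"
    unfolding cohomology_def by (rule B.factorgroup_is_group)
  have id: "comparison_map G V \<rho> 1 \<xi> = \<xi>" if "\<xi> \<in> carrier (H_abs G V \<rho> 1)" for \<xi>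
    using B.Union_rcosets_eq that unfolding comparison_map_def cohomology_def by blast
  then have "bij_betw (comparison_map G V \<rho> 1) (carrier (H_abs G V \<rho> 1)) (carrier (H_abs G V \<rho> 1))"
    using bij_betw_cong[of _ "comparison_map G V \<rho> 1" id] by auto
  moreover have "comparison_map G V \<rho> 1 \<in> hom (H_abs G V \<rho> 1) (H_abs G V \<rho> 1)"
    by (rule homI) (simp_all only: id H.m_closed)
  ultimately show ?thesis
    unfolding H_eq by (simp add: iso_def)
qed

theorem theorem2:
  fixes K :: "('k, 'r) ring_scheme"
    and G :: "('g, 's) monoid_scheme" and T :: "'g topology"
    and V :: "('k, 'v, 't) module_scheme" and \<rho> :: "'g \<Rightarrow> 'v \<Rightarrow> 'v"
    and m p :: nat
  assumes "cring K" and "ring_characteristic K = m" and "m > 0"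
    and "Factorial_Ring.prime p"
    and "p_adic_analytic_group p G T" and "compact_space T"
    and "smooth_representation K G T V \<rho>"
  shows "(\<forall>c. one_cocycle G V \<rho> c \<longrightarrow> continuous_map T (discrete_topology (carrier V)) c)
       \<and> comparison_map G V \<rho> 1 \<in> iso (H_cont G T V \<rho> 1) (H_abs G V \<rho> 1)"
proof -
  interpret smooth_representation K G T V \<rho> by fact
  have "continuous_map T (discrete_topology (carrier V)) c" if "one_cocycle G V \<rho> c" for c
    using one_cocycle_continuous[OF assms(4,5,7,2,3) that] .
  then show ?thesis
    using comparison_map_iso[OF topological_group_axioms] by blast
qed

end
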